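(* Let $\mathbb{D}=\{z\in\mathbb{C}:|z|<1\}$ and let $f$ be analytic on $\mathbb{D}$. Fix an integer $n\ge 2$. Define, for $0<r<1$, \[ \phi_{\operatorname{n-Diam}}(r)=\frac{d_n(f(r\mathbb{D}))}{d_n(\mathbb{D})\,r},\qquad \phi_{\operatorname{Cap}}(r)=\frac{\operatorname{Cap}(f(r\mathbb{D}))}{\operatorname{Cap}(r\mathbb{D})}=\frac{d_\infty(f(r\mathbb{D}))}{d_\infty(r\mathbb{D})}. \] Then $\phi_{\operatorname{Cap}}$ and $\phi_{\operatorname{n-Diam}}$ are increasing and log-convex on $(0,1)$ (i.e. convex functions of $\log r$). Moreover, they are strictly increasing on $0<r<1$ except in the special case that $f$ is linear.
   Context: For $r>0$, $r\mathbb{D}=\{z:|z|<r\}$ and $f(r\mathbb{D})=\{f(z): z\in r\mathbb{D}\}$ (image set, no multiplicity). A function is called linear if it is of the form $f(z)=az+b$ with $a,b\in\mathbb{C}$ (constants allowed). For a set $E\subset\mathbb{C}$ and $n=2,3,\dots$, the $n$-diameter is $d_n(E)=\sup\big(\prod_{1\le j<k\le n}|\zeta_j-\zeta_k|\big)^{2/(n(n-1))}$, the supremum over all $n$-tuples $\zeta_1,\dots,\zeta_n\in E$; $d_n(E)$ is weakly decreasing in $n$ and the transfinite diameter is $d_\infty(E)=\lim_{n\to\infty}d_n(E)$, which equals the logarithmic capacity $\operatorname{Cap}(E)$. One has $d_n(\mathbb{D})=n^{1/(n-1)}$ and $\operatorname{Cap}(r\mathbb{D})=r$. *)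

theory Defs
  imports "HOL-Analysis.Analysis"
begin

definition n_diam :: "nat \<Rightarrow> complex set \<Rightarrow> real" where
  "n_diam n E = Sup {(\<Prod>(j,k)\<in>{(j,k). j < k \<and> k < n}. cmod (z j - z k))
                        powr (2 / (real n * (real n - 1))) | z. \<forall>i<n. z i \<in> E}"

text \<open>Transfinite diameter (= logarithmic capacity): limit of the n-diameters.\<close>
definition trans_diam :: "complex set \<Rightarrow> real" where
  "trans_diam E = lim (\<lambda>n. n_diam n E)"

definition phi_ndiam :: "nat \<Rightarrow> (complex \<Rightarrow> complex) \<Rightarrow> real \<Rightarrow> real" where
  "phi_ndiam n f r = n_diam n (f ` ball 0 r) / (n_diam n (ball 0 1) * r)"

definition phi_cap :: "(complex \<Rightarrow> complex) \<Rightarrow> real \<Rightarrow> real" where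
  "phi_cap f r = trans_diam (f ` ball 0 r) / trans_diam (ball 0 r)"

definition log_convex_on :: "real set \<Rightarrow> (real \<Rightarrow> real) \<Rightarrow> bool" where
  "log_convex_on S g \<longleftrightarrow> convex_on (ln ` S) (\<lambda>t. g (exp t))"

definition is_linear_fun :: "(complex \<Rightarrow> complex) \<Rightarrow> complex set \<Rightarrow> bool" where
  "is_linear_fun f S \<longleftrightarrow> (\<exists>a b. \<forall>z\<in>S. f z = a * z + b)"

end

theory Submission
  imports Defs "HOL-Complex_Analysis.Complex_Analysis"
begin

text \<open>
  For points \<open>w i\<close> in the closed unit disc, the product of the differences \<open>f (w j * x) - f (w k * x)\<close> over
  pairs is holomorphic in \<open>x\<close> with a zero of order at least \<open>n choose 2\<close> at \<open>0\<close>. Dividing by that power of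
  \<open>x\<close>, the maximum principle gives monotonicity and the three circles theorem gives convexity in
  \<open>ln r\<close>; the capacity is the limit \<open>n \<rightarrow> \<infinity>\<close>.

  A quotient that is not strictly increasing is, by convexity, constant near \<open>0\<close> and equals \<open>cmod (deriv f 0)\<close>.
  For the n-diameter, the images of Fekete points of the disc under rotations and dilations are then Fekete points
  of the image, and the stationarity condition is an identity between holomorphic functions whose first
  nonlinear Taylor coefficient has to vanish. For the capacity, adding a small proportion of points near an arbitrary
  \<open>y\<close> in the image of the disc of radius \<open>r\<close> to the images of Fekete points shows
  \<open>cmod (y - f 0) \<le> r * cmod (deriv f 0)\<close>, and the equality case of Schwarz's lemma applies.
\<close>

subsection \<open>Vandermonde products and n-diameters\<close>

text \<open>The difficulty lies in strictness for the capacity. \<open>phi_cap\<close> is only the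
  pointwise limit of the \<open>phi_ndiam n\<close>: monotonicity and convexity pass to the limit,
  strictness does not, and no finite extremal configuration is left on which a stationarity
  condition could be imposed. Hence the two unrelated equality arguments. Both divide by
  \<open>deriv f 0\<close>, so a vanishing derivative has to be excluded beforehand: the image of a
  nonconstant \<open>f\<close> contains a disc around \<open>f 0\<close>, and its radius bounds the
  quotients for all \<open>n\<close> from below at once. The supremum over the open disc need not be
  attained, so Fekete points are taken in the closed disc. They turn out to lie on the circle, and
  stationarity there gives the sum (n - 1) / 2 of \<open>sum_quotients\<close>. This value is used
  twice: it determines the n-diameter of the disc, hence its capacity, and it shows that the
  function whose constancy forces linearity is real at 0 as well.\<close>

definition vdm :: "nat \<Rightarrow> (nat \<Rightarrow> complex) \<Rightarrow> complex" where
  "vdm n z = (\<Prod>k<n. \<Prod>j<k. z j - z k)"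

lemma vdm_0 [simp]: "vdm 0 z = 1"
  by (simp add: vdm_def)

lemma vdm_Suc: "vdm (Suc n) z = vdm n z * (\<Prod>j<n. z j - z n)"
  by (simp add: vdm_def)

lemma vdm_cong: "(\<And>i. i < n \<Longrightarrow> z i = w i) \<Longrightarrow> vdm n z = vdm n w"
  unfolding vdm_def by (intro prod.cong refl) auto

lemma Suc_choose_2: "Suc n choose 2 = (n choose 2) + n"
  by (simp add: numeral_2_eq_2)

lemma choose_2_pos: "n \<ge> 2 \<Longrightarrow> n choose 2 > 0"
  by (simp add: zero_less_binomial_iff)

lemma real_choose_2: "real (n choose 2) = real n * (real n - 1) / 2"
  by (induction n) (auto simp: Suc_choose_2 field_simps)

lemma vdm_affine: "vdm n (\<lambda>i. a * z i + b) = a ^ (n choose 2) * vdm n z"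
proof (induction n)
  case (Suc n)
  have "(\<Prod>j<n. (a * z j + b) - (a * z n + b)) = (\<Prod>j<n. a * (z j - z n))"
    by (intro prod.cong refl) (simp add: algebra_simps)
  also have "\<dots> = a ^ n * (\<Prod>j<n. z j - z n)"
    by (simp add: prod.distrib)
  finally show ?case
    by (simp only: vdm_Suc Suc Suc_choose_2 power_add) (simp add: mult_ac)
qed (simp add: numeral_2_eq_2)

lemma vdm_scale: "vdm n (\<lambda>i. a * z i) = a ^ (n choose 2) * vdm n z"
  using vdm_affine[of n a z 0] by simp

lemma vdm_add:
  "vdm (n + k) z = vdm n z * (\<Prod>i<k. \<Prod>j<n. z j - z (n + i)) * vdm k (\<lambda>i. z (n + i))"
proof (induction k)
  case (Suc k)
  have "(\<Prod>j<n + k. z j - x) = (\<Prod>j<n. z j - x) * (\<Prod>i<k. z (n + i) - x)" for x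
    by (induction k) (simp_all add: mult.assoc)
  then show ?case
    by (simp add: vdm_Suc Suc mult_ac)
qed simp

text \<open>Every unordered pair occurs twice on the right. Unlike \<open>vdm\<close>, this form is
  symmetric in the indices, so any index can be singled out or deleted, not only the last
  one.\<close>

lemma norm_vdm_square: "cmod (vdm n z) ^ 2 = (\<Prod>i<n. \<Prod>j\<in>{..<n} - {i}. cmod (z i - z j))"
proof (induction n)
  case (Suc n)
  have *: "(\<Prod>j\<in>{..<Suc n} - {i}. cmod (z i - z j)) = 
        (\<Prod>j\<in>{..<n} - {i}. cmod (z i - z j)) * cmod (z i - z n)" if "i < n" for i
  proof -
    have "{..<Suc n} - {i} = insert n ({..<n} - {i})" using that by auto
    then show ?thesis by (simp add: mult.commute)
  qed
  have **: "{..<Suc n} - {n} = {..<n}" by auto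
  have "(\<Prod>i<Suc n. \<Prod>j\<in>{..<Suc n} - {i}. cmod (z i - z j)) =
      (\<Prod>i<n. (\<Prod>j\<in>{..<n} - {i}. cmod (z i - z j)) * cmod (z i - z n)) * (\<Prod>j<n. cmod (z n - z j))"
    using * ** by simp
  also have "(\<Prod>j<n. cmod (z n - z j)) = (\<Prod>j<n. cmod (z j - z n))"
    by (simp add: norm_minus_commute)
  finally show ?case
    by (simp add: vdm_Suc norm_mult prod_norm[symmetric] prod.distrib power_mult_distrib Suc[symmetric] power2_eq_square)
qed simp

lemma norm_vdm_eq_pairs: "(\<Prod>(j,k)\<in>{(j,k). j < k \<and> k < n}. cmod (z j - z k)) = cmod (vdm n z)"
proof (induction n)
  case (Suc n)
  have eq: "{(j,k). j < k \<and> k < Suc n} = {(j,k). j < k \<and> k < n} \<union> (\<lambda>j. (j,n)) ` {..<n}"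
    by (auto simp: less_Suc_eq)
  have fin: "finite {(j,k). j < k \<and> k < n}"
    by (rule finite_subset[of _ "{..<n} \<times> {..<n}"]) auto
  have "(\<Prod>(j,k)\<in>{(j,k). j < k \<and> k < Suc n}. cmod (z j - z k)) = 
     (\<Prod>(j,k)\<in>{(j,k). j < k \<and> k < n}. cmod (z j - z k)) * (\<Prod>(j,k)\<in>(\<lambda>j. (j,n)) ` {..<n}. cmod (z j - z k))"
    unfolding eq by (rule prod.union_disjoint) (use fin in auto)
  also have "(\<Prod>(j,k)\<in>(\<lambda>j. (j,n)) ` {..<n}. cmod (z j - z k)) = (\<Prod>j<n. cmod (z j - z n))"
    by (subst prod.reindex) (auto simp: inj_on_def)
  finally show ?case by (simp add: Suc vdm_Suc norm_mult prod_norm[symmetric])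
qed simp

lemma n_diam_altdef:
  assumes "n \<ge> 2"
  shows "n_diam n E = Sup {root (n choose 2) (cmod (vdm n z)) | z. \<forall>i<n. z i \<in> E}"
proof -
  have "cmod (vdm n z) powr (2 / (real n * (real n - 1))) = root (n choose 2) (cmod (vdm n z))" for z
  proof (cases "vdm n z = 0")
    case False
    have "1 / real (n choose 2) = 2 / (real n * (real n - 1))"
      by (simp add: real_choose_2)
    moreover have "root (n choose 2) (cmod (vdm n z)) = cmod (vdm n z) powr (1 / real (n choose 2))"
      using False choose_2_pos[OF assms] by (intro root_powr_inverse) auto
    ultimately show ?thesis by simp
  qed simp
  then show ?thesis
    unfolding n_diam_def norm_vdm_eq_pairs by simp
qed

text \<open>Boundedness of \<open>E\<close> bounds every factor, so that the \<open>Sup\<close> in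
  \<open>n_diam\<close> is a genuine supremum.\<close>

lemma root_norm_vdm_le_n_diam:
  assumes "n \<ge> 2" "bounded E" "\<And>i. i < n \<Longrightarrow> z i \<in> E"
  shows "root (n choose 2) (cmod (vdm n z)) \<le> n_diam n E"
proof -
  have N: "n choose 2 > 0" using choose_2_pos[OF assms(1)] .
  obtain B where B: "\<And>x. x \<in> E \<Longrightarrow> cmod x \<le> B"
    using assms(2) by (auto simp: bounded_iff)
  have bdd: "bdd_above {root (n choose 2) (cmod (vdm n z)) | z. \<forall>i<n. z i \<in> E}"
  proof (rule bdd_aboveI)
    fix x assume "x \<in> {root (n choose 2) (cmod (vdm n z)) | z. \<forall>i<n. z i \<in> E}"
    then obtain w where x: "x = root (n choose 2) (cmod (vdm n w))" and w: "\<forall>i<n. w i \<in> E" by auto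
    have "cmod (vdm n w) \<le> (\<Prod>k<n. \<Prod>j<k. 2 * B)"
      unfolding vdm_def prod_norm[symmetric]
    proof (intro prod_mono conjI prod_nonneg norm_ge_zero ballI)
      fix k j assume "k \<in> {..<n}" "j \<in> {..<k}"
      then have "cmod (w j) \<le> B" "cmod (w k) \<le> B" using w B by auto
      then show "cmod (w j - w k) \<le> 2 * B"
        using norm_triangle_ineq4[of "w j" "w k"] by linarith
    qed
    then show "x \<le> root (n choose 2) (\<Prod>k<n. \<Prod>j<k. 2 * B)"
      unfolding x using N by simp
  qed
  show ?thesis
    unfolding n_diam_altdef[OF assms(1)] using assms(3) by (intro cSup_upper bdd) auto
qed

lemma norm_vdm_le_n_diam:
  assumes "n \<ge> 2" "bounded E" "\<And>i. i < n \<Longrightarrow> z i \<in> E"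
  shows "cmod (vdm n z) \<le> n_diam n E ^ (n choose 2)"
proof -
  have "root (n choose 2) (cmod (vdm n z)) ^ (n choose 2) \<le> n_diam n E ^ (n choose 2)"
    using root_norm_vdm_le_n_diam[OF assms] by (intro power_mono real_root_ge_zero) auto
  then show ?thesis using choose_2_pos[OF assms(1)] by (simp add: real_root_pow_pos2)
qed

lemma n_diam_le:
  assumes "n \<ge> 2" "E \<noteq> {}" "M \<ge> 0"
    and "\<And>z. (\<And>i. i < n \<Longrightarrow> z i \<in> E) \<Longrightarrow> cmod (vdm n z) \<le> M ^ (n choose 2)"
  shows "n_diam n E \<le> M"
  unfolding n_diam_altdef[OF assms(1)]
proof (rule cSup_least)
  show "{root (n choose 2) (cmod (vdm n z)) | z. \<forall>i<n. z i \<in> E} \<noteq> {}"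
  proof -
    obtain e where "e \<in> E" using assms(2) by auto
    then have "root (n choose 2) (cmod (vdm n (\<lambda>_. e))) \<in> {root (n choose 2) (cmod (vdm n z)) | z. \<forall>i<n. z i \<in> E}"
      by (intro CollectI exI[of _ "\<lambda>_. e"]) simp
    then show ?thesis by (rule ex_in_conv[THEN iffD1, OF exI])
  qed
  fix x assume "x \<in> {root (n choose 2) (cmod (vdm n z)) | z. \<forall>i<n. z i \<in> E}"
  then obtain w where x: "x = root (n choose 2) (cmod (vdm n w))" and w: "\<forall>i<n. w i \<in> E" by auto
  have "cmod (vdm n w) \<le> M ^ (n choose 2)" using assms(4) w by blast
  then have "root (n choose 2) (cmod (vdm n w)) \<le> root (n choose 2) (M ^ (n choose 2))"
    using choose_2_pos[OF assms(1)] by simp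
  then show "x \<le> M"
    unfolding x using choose_2_pos[OF assms(1)] assms(3) by (simp add: real_root_power_cancel)
qed

lemma n_diam_nonneg:
  assumes "n \<ge> 2" "bounded E" "E \<noteq> {}"
  shows "n_diam n E \<ge> 0"
proof -
  obtain x where "x \<in> E" using assms by auto
  then have "root (n choose 2) (cmod (vdm n (\<lambda>_. x))) \<le> n_diam n E"
    using assms by (intro root_norm_vdm_le_n_diam) auto
  moreover have "root (n choose 2) (cmod (vdm n (\<lambda>_. x))) \<ge> 0"
    by (intro real_root_ge_zero) auto
  ultimately show ?thesis by linarith
qed

lemma n_diam_mono:
  assumes "n \<ge> 2" "A \<subseteq> B" "A \<noteq> {}" "bounded B"
  shows "n_diam n A \<le> n_diam n B"
  using assms by (intro n_diam_le n_diam_nonneg norm_vdm_le_n_diam) auto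

lemma n_diam_affine_le:
  assumes "n \<ge> 2" "bounded E" "E \<noteq> {}"
  shows "n_diam n ((\<lambda>x. a * x + b) ` E) \<le> cmod a * n_diam n E"
proof (intro n_diam_le)
  show "cmod a * n_diam n E \<ge> 0" using n_diam_nonneg[OF assms] by simp
  fix z assume z: "\<And>i. i < n \<Longrightarrow> z i \<in> (\<lambda>x. a * x + b) ` E"
  then have "\<forall>i. \<exists>x. i < n \<longrightarrow> x \<in> E \<and> z i = a * x + b" by blast
  then obtain x where x: "\<And>i. i < n \<Longrightarrow> x i \<in> E \<and> z i = a * x i + b" by metis
  have "vdm n z = a ^ (n choose 2) * vdm n x"
    using x vdm_cong[of n z "\<lambda>i. a * x i + b"] by (simp add: vdm_affine)
  then show "cmod (vdm n z) \<le> (cmod a * n_diam n E) ^ (n choose 2)"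
    using norm_vdm_le_n_diam[of n E x] assms x
    by (simp add: norm_mult norm_power power_mult_distrib mult_left_mono)
qed (use assms in auto)

text \<open>For nonzero \<open>a\<close> the missing inequality is \<open>n_diam_affine_le\<close>
  for the inverse affine map.\<close>

lemma n_diam_affine:
  assumes "n \<ge> 2" "bounded E" "E \<noteq> {}"
  shows "n_diam n ((\<lambda>x. a * x + b) ` E) = cmod a * n_diam n E"
proof (cases "a = 0")
  case True
  have "bounded ((\<lambda>x. a * x + b) ` E)" using True by (intro finite_imp_bounded) (auto intro: finite_subset[of _ "{b}"])
  then show ?thesis
    using n_diam_affine_le[OF assms, of a b] n_diam_nonneg[of n "(\<lambda>x. a * x + b) ` E"] assms True by simp
next
  case False
  have bd: "bounded ((\<lambda>x. a * x + b) ` E)"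
  proof -
    have "bounded ((\<lambda>x. b + x) ` (\<lambda>x. a * x) ` E)"
      using assms by (intro bounded_translation bounded_linear_image bounded_linear_mult_right)
    then show ?thesis by (simp add: image_image add.commute)
  qed
  have "(\<lambda>x. (1 / a) * x + (- b / a)) ` (\<lambda>x. a * x + b) ` E = E"
    using False by (simp add: image_image field_simps)
  then have "n_diam n E \<le> cmod (1 / a) * n_diam n ((\<lambda>x. a * x + b) ` E)"
    using n_diam_affine_le[OF assms(1) bd, of "1 / a" "- b / a"] assms(3) by simp
  then show ?thesis
    using n_diam_affine_le[OF assms, of a b] False by (simp add: norm_divide field_simps)
qed

lemma n_diam_ball:
  assumes "n \<ge> 2" "r > 0"
  shows "n_diam n (ball c r) = r * n_diam n (ball 0 1)"
proof -
  have "ball c r = (\<lambda>x. of_real r * x + c) ` ball 0 1"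
  proof (intro equalityI subsetI)
    fix x assume "x \<in> ball c r"
    then have "(x - c) / of_real r \<in> ball 0 1" "x = of_real r * ((x - c) / of_real r) + c"
      using assms by (auto simp: dist_norm norm_divide norm_minus_commute)
    then show "x \<in> (\<lambda>x. of_real r * x + c) ` ball 0 1" by blast
  qed (use assms in \<open>auto simp: dist_norm norm_mult norm_minus_commute\<close>)
  then show ?thesis
    using n_diam_affine[of n "ball 0 1" "of_real r" c] assms by simp
qed

subsection \<open>Monotonicity in the number of points\<close>

text \<open>Deleting an index from an initial segment leaves a set that need not be one, so the
  bound is stated for an arbitrary index set of size \<open>n\<close>; the symmetric double product
  makes the enumeration irrelevant.\<close>

lemma prod_delete_le_n_diam:
  assumes "n \<ge> 2" "bounded E" "finite A" "card A = n" "\<And>i. i \<in> A \<Longrightarrow> z i \<in> E"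
  shows "(\<Prod>i\<in>A. \<Prod>j\<in>A - {i}. cmod (z i - z j)) \<le> n_diam n E ^ (2 * (n choose 2))"
proof -
  obtain h where h: "bij_betw h {..<n} A"
    using finite_same_card_bij[of "{..<n}" A] assms by auto
  have inj: "inj_on h {..<n}" and A: "A = h ` {..<n}" using h by (auto simp: bij_betw_def)
  have "(\<Prod>i\<in>A. \<Prod>j\<in>A - {i}. cmod (z i - z j)) = (\<Prod>i<n. \<Prod>j\<in>A - {h i}. cmod (z (h i) - z j))"
    using inj unfolding A by (simp add: prod.reindex)
  also have "\<dots> = (\<Prod>i<n. \<Prod>j\<in>{..<n} - {i}. cmod (z (h i) - z (h j)))"
  proof (intro prod.cong refl)
    fix i assume i: "i \<in> {..<n}"
    then have "A - {h i} = h ` ({..<n} - {i})"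
      using inj unfolding A inj_on_def by blast
    moreover have "inj_on h ({..<n} - {i})" using inj by (rule inj_on_subset) auto
    ultimately show "(\<Prod>j\<in>A - {h i}. cmod (z (h i) - z j)) = (\<Prod>j\<in>{..<n} - {i}. cmod (z (h i) - z (h j)))"
      by (simp add: prod.reindex)
  qed
  also have "\<dots> = cmod (vdm n (z \<circ> h)) ^ 2"
    by (simp add: norm_vdm_square)
  also have "\<dots> \<le> (n_diam n E ^ (n choose 2)) ^ 2"
    using assms A by (intro power_mono norm_vdm_le_n_diam) auto
  finally show ?thesis by (simp add: power_mult[symmetric] mult.commute)
qed

text \<open>Double counting: deleting one of \<open>n + 1\<close> points leaves \<open>n\<close>
  points, to which the bound for \<open>n\<close> applies. In the product over all deletions each
  factor \<open>a j k\<close> survives the deletion of the \<open>n - 1\<close> indices other than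
  \<open>j\<close> and \<open>k\<close>.\<close>

lemma n_diam_Suc_le:
  assumes "n \<ge> 2" "bounded E" "E \<noteq> {}"
  shows "n_diam (Suc n) E \<le> n_diam n E"
proof (rule n_diam_le)
  show D: "n_diam n E \<ge> 0" using n_diam_nonneg[OF assms] .
  fix z assume z: "\<And>i. i < Suc n \<Longrightarrow> z i \<in> E"
  define A where "A = {..<Suc n}"
  define a where "a = (\<lambda>j k. cmod (z j - z k))"
  have fin: "finite A" and cardA: "card A = Suc n" by (auto simp: A_def)
  have *: "A - {i} = {j. j \<in> A \<and> i \<noteq> j}" "A - {i} = {j. j \<in> A \<and> j \<noteq> i}" for i by auto
  have "(\<Prod>i\<in>A. \<Prod>j\<in>A - {i}. \<Prod>k\<in>A - {i} - {j}. a j k) =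
        (\<Prod>j\<in>A. \<Prod>i\<in>A - {j}. \<Prod>k\<in>A - {i} - {j}. a j k)"
    using prod.swap_restrict[OF fin fin, of "\<lambda>i j. \<Prod>k\<in>A - {i} - {j}. a j k" "\<lambda>i j. i \<noteq> j"]
    unfolding *(1)[symmetric] *(2)[symmetric] .
  also have "\<dots> = (\<Prod>j\<in>A. \<Prod>k\<in>A - {j}. a j k ^ (n - 1))"
  proof (rule prod.cong[OF refl])
    fix j assume j: "j \<in> A"
    define B where "B = A - {j}"
    have finB: "finite B" and cardB: "card B = n" using fin cardA j by (auto simp: B_def)
    have **: "B - {i} = {j. j \<in> B \<and> i \<noteq> j}" "B - {i} = {j. j \<in> B \<and> j \<noteq> i}" for i by auto
    have "(\<Prod>i\<in>B. \<Prod>k\<in>B - {i}. a j k) = (\<Prod>k\<in>B. \<Prod>i\<in>B - {k}. a j k)"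
      using prod.swap_restrict[OF finB finB, of "\<lambda>i k. a j k" "\<lambda>i j. i \<noteq> j"]
      unfolding **(1)[symmetric] **(2)[symmetric] .
    also have "\<dots> = (\<Prod>k\<in>B. a j k ^ (n - 1))"
      using finB cardB by (intro prod.cong refl) simp
    finally show "(\<Prod>i\<in>A - {j}. \<Prod>k\<in>A - {i} - {j}. a j k) = (\<Prod>k\<in>A - {j}. a j k ^ (n - 1))"
      by (simp add: B_def Diff_insert2[symmetric] insert_commute)
  qed
  also have "\<dots> = (cmod (vdm (Suc n) z) ^ 2) ^ (n - 1)"
    by (simp add: norm_vdm_square A_def a_def prod_power_distrib del: prod.lessThan_Suc)
  finally have eq: "(\<Prod>i\<in>A. \<Prod>j\<in>A - {i}. \<Prod>k\<in>A - {i} - {j}. a j k) = (cmod (vdm (Suc n) z) ^ 2) ^ (n - 1)" .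
  have "(\<Prod>i\<in>A. \<Prod>j\<in>A - {i}. \<Prod>k\<in>A - {i} - {j}. a j k) \<le> (\<Prod>i\<in>A. n_diam n E ^ (2 * (n choose 2)))"
    using fin cardA z assms unfolding a_def
    by (intro prod_mono conjI prod_nonneg prod_delete_le_n_diam) (auto simp: A_def)
  also have "\<dots> = (n_diam n E ^ (Suc n choose 2)) ^ (2 * (n - 1))"
  proof -
    \<comment> \<open>Both sides are (n + 1) n (n - 1).\<close>
    have "2 * (n choose 2) * Suc n = (Suc n choose 2) * (2 * (n - 1))"
    proof -
      have "real (2 * (n choose 2) * Suc n) = real ((Suc n choose 2) * (2 * (n - 1)))"
        using assms(1) by (simp only: of_nat_mult real_choose_2) (simp add: of_nat_diff algebra_simps)
      then show ?thesis by linarith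
    qed
    then show ?thesis by (simp only: prod_constant cardA power_mult[symmetric])
  qed
  finally have "cmod (vdm (Suc n) z) ^ (2 * (n - 1)) \<le> (n_diam n E ^ (Suc n choose 2)) ^ (2 * (n - 1))"
    unfolding eq by (simp only: power_mult)
  then show "cmod (vdm (Suc n) z) \<le> n_diam n E ^ (Suc n choose 2)"
    using D assms(1) by (subst (asm) power_mono_iff) auto
qed (use assms in auto)

lemma n_diam_tendsto_trans_diam:
  assumes "bounded E" "E \<noteq> {}"
  shows "(\<lambda>n. n_diam n E) \<longlonglongrightarrow> trans_diam E"
proof -
  \<comment> \<open>Monotonicity is available from index 2 on only; a shift does not affect the
    limit.\<close>
  have "decseq (\<lambda>n. n_diam (n + 2) E)"
    using assms by (intro decseq_SucI) (simp add: n_diam_Suc_le)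
  then obtain L where "(\<lambda>n. n_diam (n + 2) E) \<longlonglongrightarrow> L"
  proof (rule decseq_convergent[where B = 0])
    show "\<forall>i. 0 \<le> n_diam (i + 2) E" using assms by (simp add: n_diam_nonneg)
  qed
  then have "(\<lambda>n. n_diam n E) \<longlonglongrightarrow> L"
    by (rule LIMSEQ_offset)
  then show ?thesis unfolding trans_diam_def by (simp add: limI)
qed

subsection \<open>Fekete points of the disc\<close>

text \<open>Needed because the maximum principle looks at configurations on a circle, whereas
  \<open>n_diam\<close> is taken over the image of an open disc.\<close>

lemma norm_vdm_le_n_diam_closure:
  assumes "n \<ge> 2" "bounded E" "\<And>i. i < n \<Longrightarrow> z i \<in> closure E"
  shows "cmod (vdm n z) \<le> n_diam n E ^ (n choose 2)"
proof -
  have "\<forall>i. \<exists>x. i < n \<longrightarrow> (\<forall>m. x m \<in> E) \<and> x \<longlonglongrightarrow> z i"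
    using assms(3) by (auto simp: closure_sequential)
  then obtain x where x: "\<And>i. i < n \<Longrightarrow> (\<forall>m. x i m \<in> E) \<and> x i \<longlonglongrightarrow> z i" by metis
  have "(\<lambda>m. vdm n (\<lambda>i. x i m)) \<longlonglongrightarrow> vdm n z"
    unfolding vdm_def by (intro tendsto_prod tendsto_diff) (use x in auto)
  then have "(\<lambda>m. cmod (vdm n (\<lambda>i. x i m))) \<longlonglongrightarrow> cmod (vdm n z)"
    by (rule tendsto_norm)
  then show ?thesis
    by (rule LIMSEQ_le_const2) (use norm_vdm_le_n_diam[OF assms(1,2)] x in auto)
qed

text \<open>Isolates the dependence on \<open>z j\<close>. The square root of the symmetric double
  product stands for the Vandermonde modulus of the remaining points, which avoids renumbering
  them.\<close>

lemma norm_vdm_split_index: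
  assumes "j < n"
  shows "cmod (vdm n z) = cmod (\<Prod>k\<in>{..<n} - {j}. z j - z k) *
     sqrt (\<Prod>i\<in>{..<n} - {j}. \<Prod>k\<in>{..<n} - {i} - {j}. cmod (z i - z k))"
proof -
  let ?A = "{..<n}" and ?c = "\<lambda>i k. cmod (z i - z k)"
  have "cmod (vdm n z) ^ 2 = (\<Prod>k\<in>?A - {j}. ?c j k) * (\<Prod>i\<in>?A - {j}. \<Prod>k\<in>?A - {i}. ?c i k)"
    unfolding norm_vdm_square using assms by (subst prod.remove[of _ j]) auto
  also have "(\<Prod>i\<in>?A - {j}. \<Prod>k\<in>?A - {i}. ?c i k) =
      (\<Prod>i\<in>?A - {j}. ?c i j * (\<Prod>k\<in>?A - {i} - {j}. ?c i k))"
    using assms by (intro prod.cong refl prod.remove) auto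
  also have "\<dots> = (\<Prod>k\<in>?A - {j}. ?c j k) * (\<Prod>i\<in>?A - {j}. \<Prod>k\<in>?A - {i} - {j}. ?c i k)"
    by (simp add: prod.distrib norm_minus_commute)
  finally have "cmod (vdm n z) ^ 2 = (cmod (\<Prod>k\<in>?A - {j}. z j - z k) *
     sqrt (\<Prod>i\<in>?A - {j}. \<Prod>k\<in>?A - {i} - {j}. ?c i k)) ^ 2"
    by (simp add: power_mult_distrib prod_norm prod_nonneg power2_eq_square)
  then show ?thesis
    by (subst (asm) power2_eq_iff_nonneg) (auto intro!: prod_nonneg mult_nonneg_nonneg)
qed

lemma norm_prod_diff_le_if_vdm_le:
  assumes "j < n" "vdm n z \<noteq> 0" "cmod (vdm n (z(j := x))) \<le> cmod (vdm n z)"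
  shows "cmod (\<Prod>k\<in>{..<n} - {j}. x - z k) \<le> cmod (\<Prod>k\<in>{..<n} - {j}. z j - z k)"
proof -
  define R where "R = (\<lambda>z. sqrt (\<Prod>i\<in>{..<n} - {j}. \<Prod>k\<in>{..<n} - {i} - {j}. cmod (z i - z k)))"
  have R: "R (z(j := x)) = R z"
    unfolding R_def by (intro arg_cong[of _ _ sqrt] prod.cong refl) auto
  have z: "cmod (vdm n z) = cmod (\<Prod>k\<in>{..<n} - {j}. z j - z k) * R z"
    unfolding R_def by (rule norm_vdm_split_index[OF assms(1)])
  have "cmod (vdm n (z(j := x))) = cmod (\<Prod>k\<in>{..<n} - {j}. x - (z(j := x)) k) * R z"
    unfolding R[symmetric] R_def using norm_vdm_split_index[OF assms(1), of "z(j := x)"] by simp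
  also have "(\<Prod>k\<in>{..<n} - {j}. x - (z(j := x)) k) = (\<Prod>k\<in>{..<n} - {j}. x - z k)"
    by (intro prod.cong) auto
  finally have zx: "cmod (vdm n (z(j := x))) = cmod (\<Prod>k\<in>{..<n} - {j}. x - z k) * R z" .
  have "R z \<ge> 0" unfolding R_def by (auto intro!: prod_nonneg)
  moreover have "R z \<noteq> 0" using z assms(2) by auto
  ultimately show ?thesis using assms(3) z zx by simp
qed

lemma vdm_nonzero_iff: "vdm n z \<noteq> 0 \<longleftrightarrow> inj_on z {..<n}"
proof
  assume nz: "vdm n z \<noteq> 0"
  then have *: "z j \<noteq> z k" if "j < k" "k < n" for j k
    using that by (auto simp: vdm_def)
  then show "inj_on z {..<n}"
    by (auto simp: inj_on_def) (metis linorder_neqE_nat)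
next
  assume "inj_on z {..<n}"
  then show "vdm n z \<noteq> 0"
    by (fastforce simp: vdm_def inj_on_def)
qed

text \<open>The maximum is taken over the product of closed discs over all of \<open>nat\<close>,
  compact by Tychonoff; \<open>vdm n\<close> depends on finitely many coordinates. A competitor
  \<open>w\<close> is controlled below \<open>n\<close> only, so its other coordinates are reset to
  0.\<close>

lemma fekete_points_exist:
  obtains z where "\<And>i. cmod (z i) \<le> 1"
    "\<And>w. (\<And>i. i < n \<Longrightarrow> cmod (w i) \<le> 1) \<Longrightarrow> cmod (vdm n w) \<le> cmod (vdm n z)"
proof -
  define S where "S = (PiE UNIV (\<lambda>_. cball 0 1) :: (nat \<Rightarrow> complex) set)"
  have "compactin (product_topology (\<lambda>_. euclidean) UNIV) S"
    unfolding S_def compactin_PiE by auto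
  then have "compact S" by (simp add: euclidean_product_topology)
  moreover have "S \<noteq> {}" by (auto simp: S_def PiE_eq_empty_iff)
  moreover have "continuous_on S (\<lambda>z. cmod (vdm n z))"
    unfolding vdm_def
    by (intro continuous_intros continuous_on_subset[OF continuous_on_product_coordinates]) auto
  ultimately obtain z where z: "z \<in> S" "\<forall>w\<in>S. cmod (vdm n w) \<le> cmod (vdm n z)"
    by (blast dest: continuous_attains_sup)
  show thesis
  proof
    show "cmod (z i) \<le> 1" for i using z(1) by (auto simp: S_def PiE_def Pi_def)
    fix w assume w: "\<And>i. i < n \<Longrightarrow> cmod (w i) \<le> 1"
    have "(\<lambda>i. if i < n then w i else 0) \<in> S" using w by (auto simp: S_def)
    then have "cmod (vdm n (\<lambda>i. if i < n then w i else 0)) \<le> cmod (vdm n z)" using z by blast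
    also have "vdm n (\<lambda>i. if i < n then w i else 0) = vdm n w" by (rule vdm_cong) auto
    finally show "cmod (vdm n w) \<le> cmod (vdm n z)" .
  qed
qed

section \<open>Stationarity at a maximum on a circle\<close>

lemma has_field_derivative_prod_log:
  fixes f :: "'a \<Rightarrow> 'b::real_normed_field \<Rightarrow> 'b"
  assumes "finite A" "\<And>k. k \<in> A \<Longrightarrow> (f k has_field_derivative f' k) (at x)" "\<And>k. k \<in> A \<Longrightarrow> f k x \<noteq> 0"
  shows "((\<lambda>y. \<Prod>k\<in>A. f k y) has_field_derivative (\<Prod>k\<in>A. f k x) * (\<Sum>k\<in>A. f' k / f k x)) (at x)"
  using assms
proof (induction A rule: finite_induct)
  case (insert a A)
  have "((\<lambda>y. f a y * (\<Prod>k\<in>A. f k y)) has_field_derivative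
     f' a * (\<Prod>k\<in>A. f k x) + ((\<Prod>k\<in>A. f k x) * (\<Sum>k\<in>A. f' k / f k x)) * f a x) (at x)"
    using insert by (intro DERIV_mult) auto
  moreover have "f' a * (\<Prod>k\<in>A. f k x) + ((\<Prod>k\<in>A. f k x) * (\<Sum>k\<in>A. f' k / f k x)) * f a x =
     (\<Prod>k\<in>insert a A. f k x) * (\<Sum>k\<in>insert a A. f' k / f k x)"
    using insert by (simp add: field_simps)
  ultimately show ?case using insert by simp
qed simp

text \<open>The quantity below is, up to sign, the tangential derivative of \<open>ln (cmod (G x))\<close> along the circle.\<close>

lemma Im_log_derivative_eq_0_at_max:
  assumes G: "(G has_field_derivative G') (at z)" and nz: "G z \<noteq> 0"
    and max: "\<And>x. cmod x = cmod z \<Longrightarrow> cmod (G x) \<le> cmod (G z)"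
  shows "Im (z * G' / G z) = 0"
proof -
  define Q where "Q = (\<lambda>w. G (z * exp (\<i> * w)) / G z)"
  have "(G has_field_derivative G') (at (z * exp (\<i> * of_real 0)))" using G by simp
  then have "(Q has_field_derivative (\<i> * (z * G' / G z))) (at (of_real 0))"
    unfolding Q_def
    by (auto intro!: derivative_eq_intros DERIV_chain2[of G] simp: nz)
  then have "((\<lambda>t. Q (of_real t)) has_vector_derivative (\<i> * (z * G' / G z))) (at 0)"
    by (rule has_vector_derivative_real_field)
  then have "((\<lambda>t. Re (Q (of_real t))) has_vector_derivative Re (\<i> * (z * G' / G z))) (at 0)"
    by (rule bounded_linear.has_vector_derivative[OF bounded_linear_Re])
  then have der: "DERIV (\<lambda>t. Re (Q (of_real t))) 0 :> Re (\<i> * (z * G' / G z))"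
    by (simp add: has_real_derivative_iff_has_vector_derivative)
  have "Re (Q (of_real t)) \<le> Re (Q (of_real 0))" for t
  proof -
    have "cmod (z * exp (\<i> * of_real t)) = cmod z" by (simp add: norm_mult)
    then have "cmod (Q (of_real t)) \<le> 1"
      unfolding Q_def using max nz by (simp add: norm_divide)
    then show ?thesis using complex_Re_le_cmod[of "Q (of_real t)"] by (simp add: Q_def nz)
  qed
  then have "Re (\<i> * (z * G' / G z)) = 0"
    using DERIV_local_max[OF der, of 1] by auto
  then show ?thesis unfolding Re_i_times by simp
qed

text \<open>\<open>w = a / (a - b)\<close> and \<open>w - 1 = b / (a - b)\<close> have the same
  modulus, so \<open>w\<close> is equidistant from 0 and 1.\<close>

lemma Re_unit_quotient:
  assumes "cmod a = 1" "cmod b = 1" "a \<noteq> b"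
  shows "Re (a / (a - b)) = 1 / 2"
proof -
  define w where "w = a / (a - b)"
  have "w - 1 = b / (a - b)" using assms by (simp add: w_def field_simps)
  then have "cmod w = cmod (w - 1)" using assms by (simp add: w_def norm_divide)
  then have "cmod w ^ 2 = cmod (w - 1) ^ 2" by simp
  then have "Re w = 1 / 2" unfolding cmod_power2 by (simp add: power2_eq_square algebra_simps)
  then show ?thesis by (simp add: w_def)
qed

locale fekete =
  fixes n :: nat and z :: "nat \<Rightarrow> complex"
  assumes n2: "n \<ge> 2"
    and in_disc: "\<And>i. cmod (z i) \<le> 1"
    and maximal: "\<And>w. (\<And>i. i < n \<Longrightarrow> cmod (w i) \<le> 1) \<Longrightarrow> cmod (vdm n w) \<le> cmod (vdm n z)"
begin

lemma vdm_nonzero: "vdm n z \<noteq> 0"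
proof -
  let ?w = "\<lambda>i::nat. inverse (of_nat (Suc i)) :: complex"
  have "inj_on ?w {..<n}" by (auto simp: inj_on_def simp del: of_nat_Suc)
  then have "vdm n ?w \<noteq> 0" by (simp only: vdm_nonzero_iff)
  moreover have "cmod (?w i) \<le> 1" for i
    unfolding norm_inverse norm_of_nat by (rule inverse_le_1_iff[THEN iffD2]) simp
  ultimately show ?thesis using maximal[of ?w] by auto
qed

lemma distinct: "inj_on z {..<n}"
  using vdm_nonzero by (simp add: vdm_nonzero_iff)

lemma norm_prod_diff_le:
  assumes "j < n" "cmod x \<le> 1"
  shows "cmod (\<Prod>k\<in>{..<n} - {j}. x - z k) \<le> cmod (\<Prod>k\<in>{..<n} - {j}. z j - z k)"
  using assms in_disc
  by (intro norm_prod_diff_le_if_vdm_le vdm_nonzero maximal) auto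

text \<open>As a function of the \<open>j\<close>-th point alone, the product is a polynomial
  \<open>G\<close> with its maximum over the disc at \<open>z j\<close>. An interior maximum would
  make \<open>G\<close> constant, yet \<open>G\<close> vanishes at the other points and not at
  \<open>z j\<close>.\<close>

lemma norm_eq_1:
  assumes "j < n" shows "cmod (z j) = 1"
proof (rule ccontr)
  define G where "G = (\<lambda>x. \<Prod>k\<in>{..<n} - {j}. x - z k)"
  assume "cmod (z j) \<noteq> 1"
  then have zj: "z j \<in> ball 0 1" using in_disc[of j] by auto
  have "G constant_on ball 0 1"
  proof (rule maximum_modulus_principle[where \<xi> = "z j" and U = "ball 0 1"])
    show "G holomorphic_on ball 0 1" unfolding G_def by (intro holomorphic_intros)
    show "cmod (G x) \<le> cmod (G (z j))" if "x \<in> ball 0 1" for x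
      unfolding G_def using that assms by (intro norm_prod_diff_le) auto
  qed (use zj in auto)
  then obtain c where "\<And>x. x \<in> ball 0 1 \<Longrightarrow> G x = c"
    by (auto simp: constant_on_def)
  moreover have "continuous_on (closure (ball 0 1)) G"
    unfolding G_def by (intro continuous_intros)
  ultimately have c: "\<And>x. x \<in> cball 0 1 \<Longrightarrow> G x = c"
    using continuous_constant_on_closure[of "ball 0 1" G c] by simp
  obtain k where k: "k < n" "k \<noteq> j"
  proof (cases "j = 0")
    case True then show ?thesis using n2 that[of 1] by auto
  next
    case False then show ?thesis using n2 that[of 0] by auto
  qed
  have "G (z k) = 0" unfolding G_def using k by auto
  moreover have "G (z j) \<noteq> 0" unfolding G_def using distinct assms by (auto simp: inj_on_def)
  ultimately show False using c[of "z k"] c[of "z j"] in_disc[of k] in_disc[of j] by auto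
qed

text \<open>The real part needs only that the points lie on the circle, each summand contributing
  1/2. The imaginary part vanishes because \<open>z j\<close> is stationary under rotation.\<close>

lemma sum_quotients:
  assumes "j < n"
  shows "(\<Sum>k\<in>{..<n} - {j}. z j / (z j - z k)) = of_real ((real n - 1) / 2)"
proof (rule complex_eqI)
  have ne: "z j \<noteq> z k" if "k \<in> {..<n} - {j}" for k
    using distinct assms that by (auto simp: inj_on_def)
  have "Re (\<Sum>k\<in>{..<n} - {j}. z j / (z j - z k)) = (\<Sum>k\<in>{..<n} - {j}. 1 / 2)"
    unfolding Re_sum using ne norm_eq_1 assms by (intro sum.cong refl Re_unit_quotient) auto
  also have "\<dots> = (real n - 1) / 2" using assms by (simp add: of_nat_diff)
  finally show "Re (\<Sum>k\<in>{..<n} - {j}. z j / (z j - z k)) = Re (of_real ((real n - 1) / 2))" by simp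
  define G where "G = (\<lambda>x. \<Prod>k\<in>{..<n} - {j}. x - z k)"
  have "(G has_field_derivative G (z j) * (\<Sum>k\<in>{..<n} - {j}. 1 / (z j - z k))) (at (z j))"
    unfolding G_def using ne
    by (intro has_field_derivative_prod_log) (auto intro!: derivative_eq_intros)
  moreover have Gnz: "G (z j) \<noteq> 0" unfolding G_def using ne by auto
  moreover have "cmod (G x) \<le> cmod (G (z j))" if "cmod x = cmod (z j)" for x
    unfolding G_def using that in_disc[of j] assms by (intro norm_prod_diff_le) auto
  ultimately have "Im (z j * (G (z j) * (\<Sum>k\<in>{..<n} - {j}. 1 / (z j - z k))) / G (z j)) = 0"
    by (rule Im_log_derivative_eq_0_at_max)
  moreover have "z j * (G (z j) * (\<Sum>k\<in>{..<n} - {j}. 1 / (z j - z k))) / G (z j) =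
      (\<Sum>k\<in>{..<n} - {j}. z j / (z j - z k))"
    using Gnz by (simp add: sum_distrib_left field_simps)
  ultimately show "Im (\<Sum>k\<in>{..<n} - {j}. z j / (z j - z k)) = Im (of_real ((real n - 1) / 2))"
    by simp
qed

text \<open>By stationarity, \<open>x P'' - (n - 1) P'\<close> vanishes at all \<open>n\<close> zeros of \<open>P = (\<Prod>k<n. x - z k)\<close>,
  hence identically, which forces \<open>P = x ^ n - const\<close>.\<close>

lemma norm_vdm: "cmod (vdm n z) ^ 2 = real n ^ n"
proof -
  define P where "P = (\<Prod>k<n. [:- z k, 1:])"
  define Q where "Q = (\<lambda>j. \<Prod>k\<in>{..<n} - {j}. [:- z k, 1:])"
  have PQ: "P = [:- z j, 1:] * Q j" if "j < n" for j
    unfolding P_def Q_def using that by (subst prod.remove[of _ j]) auto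
  have degP: "degree P = n" unfolding P_def by (subst degree_prod_eq_sum_degree) auto
  have leadP: "coeff P n = 1"
    using degP lead_coeff_prod[of "\<lambda>k. [:- z k, 1:]" "{..<n}"] by (simp add: P_def)
  have polyQ: "poly (Q j) = (\<lambda>x. \<Prod>k\<in>{..<n} - {j}. x - z k)" for j
    by (auto simp: Q_def poly_prod)
  have P': "poly (pderiv P) (z j) = poly (Q j) (z j)" if "j < n" for j
    by (simp add: PQ[OF that] pderiv_mult pderiv_pCons del: mult_pCons_left)
  have P'': "poly (pderiv (pderiv P)) (z j) = 2 * poly (pderiv (Q j)) (z j)" if "j < n" for j
    by (simp add: PQ[OF that] pderiv_mult pderiv_add pderiv_pCons del: mult_pCons_left)
  have Q': "poly (pderiv (Q j)) (z j) = poly (Q j) (z j) * (\<Sum>k\<in>{..<n} - {j}. 1 / (z j - z k))" if "j < n" for j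
  proof -
    have "z j \<noteq> z k" if "k \<in> {..<n} - {j}" for k
      using distinct \<open>j < n\<close> that by (auto simp: inj_on_def)
    then have "(poly (Q j) has_field_derivative poly (Q j) (z j) * (\<Sum>k\<in>{..<n} - {j}. 1 / (z j - z k))) (at (z j))"
      unfolding polyQ by (intro has_field_derivative_prod_log) (auto intro!: derivative_eq_intros)
    then show ?thesis using poly_DERIV DERIV_unique by blast
  qed
  define R where "R = pCons 0 (pderiv (pderiv P)) - smult (of_real (real n - 1)) (pderiv P)"
  have root: "poly R (z j) = 0" if "j < n" for j
  proof -
    have "z j * (\<Sum>k\<in>{..<n} - {j}. 1 / (z j - z k)) = of_real ((real n - 1) / 2)"
      using sum_quotients[OF that] by (simp add: sum_distrib_left)
    then have "2 * (poly (Q j) (z j) * (z j * (\<Sum>k\<in>{..<n} - {j}. 1 / (z j - z k)))) =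
      of_real (real n - 1) * poly (Q j) (z j)"
      by (simp only:) simp
    then show ?thesis by (simp add: R_def P' P'' Q' that algebra_simps)
  qed
  \<comment> \<open>Once \<open>R = 0\<close>, the middle factor shows that a coefficient of
    \<open>P\<close> of positive degree other than \<open>n\<close> must vanish.\<close>
  have coeffR: "coeff R i = of_nat (Suc i) * (of_nat i - of_real (real n - 1)) * coeff P (Suc i)" for i
    by (cases i) (simp_all add: R_def coeff_pderiv algebra_simps)
  have R0: "R = 0"
  proof (rule ccontr)
    assume "R \<noteq> 0"
    have "degree R \<le> n - 1"
    proof (rule degree_le, intro allI impI)
      fix i assume "n - 1 < i"
      then have "coeff P (Suc i) = 0" by (intro coeff_eq_0) (simp add: degP)
      then show "coeff R i = 0" by (simp add: coeffR)
    qed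
    moreover have "card (z ` {..<n}) \<le> card {x. poly R x = 0}"
      using root by (intro card_mono poly_roots_finite \<open>R \<noteq> 0\<close>) auto
    moreover have "card {x. poly R x = 0} \<le> degree R" using \<open>R \<noteq> 0\<close> by (rule card_poly_roots_bound)
    ultimately show False using n2 card_image[OF distinct] by simp
  qed
  have "pderiv P = monom (of_nat n) (n - 1)"
  proof (rule poly_eqI)
    fix i
    show "coeff (pderiv P) i = coeff (monom (of_nat n) (n - 1)) i"
    proof (cases "i = n - 1")
      case True then show ?thesis using n2 leadP by (simp add: coeff_pderiv)
    next
      case False
      then have "of_nat i \<noteq> (of_real (real n - 1) :: complex)"
        using n2 by (metis (no_types) Suc_le_D diff_Suc_1 of_nat_Suc of_nat_eq_iff of_real_eq_iff of_real_of_nat_eq add_diff_cancel_left' numeral_2_eq_2)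
      then have "coeff P (Suc i) = 0" using coeffR[of i] R0 by (simp del: of_nat_Suc)
      then show ?thesis using False by (simp add: coeff_pderiv)
    qed
  qed
  \<comment> \<open>The product is the value of P' at \<open>z j\<close>, and P' = n x^(n - 1) has
    modulus \<open>n\<close> on the unit circle.\<close>
  then have "cmod (\<Prod>k\<in>{..<n} - {j}. z j - z k) = real n" if "j < n" for j
    using P'[OF that] norm_eq_1[OF that] unfolding polyQ
    by (simp add: poly_monom norm_mult norm_power) (metis norm_of_nat norm_mult norm_power mult.right_neutral power_one)
  then show ?thesis
    unfolding norm_vdm_square by (simp add: prod_norm)
qed

end

lemma fekete_ex: 
  assumes "n \<ge> 2"
  obtains z where "fekete n z"
  using fekete_points_exist[of n] assms by (metis fekete.intro)

lemma (in fekete) n_diam_unit_ball: "n_diam n (ball 0 1) ^ (n choose 2) = cmod (vdm n z)"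
proof (rule antisym)
  have "n_diam n (ball 0 1) \<le> root (n choose 2) (cmod (vdm n z))"
    using n2 choose_2_pos[OF n2] by (intro n_diam_le) (simp_all add: maximal less_imp_le)
  then have "n_diam n (ball 0 1) ^ (n choose 2) \<le> root (n choose 2) (cmod (vdm n z)) ^ (n choose 2)"
    using n2 by (intro power_mono n_diam_nonneg) auto
  then show "n_diam n (ball 0 1) ^ (n choose 2) \<le> cmod (vdm n z)"
    using choose_2_pos[OF n2] by simp
  show "cmod (vdm n z) \<le> n_diam n (ball 0 1) ^ (n choose 2)"
    using n2 in_disc by (intro norm_vdm_le_n_diam_closure) auto
qed

lemma n_diam_unit_ball:
  assumes "n \<ge> 2"
  shows "n_diam n (ball 0 1) = root (n - 1) n"
proof -
  obtain z where "fekete n z" using fekete_ex[OF assms] .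
  then interpret fekete n z .
  let ?d = "n_diam n (ball 0 1)"
  have d: "?d \<ge> 0" using assms by (intro n_diam_nonneg) auto
  have "2 * (n choose 2) = (n - 1) * n"
    using assms by (simp add: choose_two)
  then have "(?d ^ (n - 1)) ^ n = real n ^ n"
    using norm_vdm by (simp add: n_diam_unit_ball[symmetric] power_mult[symmetric] mult_ac)
  then have "?d ^ (n - 1) = real n"
    using assms d by (subst (asm) power_eq_iff_eq_base) auto
  then show ?thesis
    using assms d by (simp add: real_root_pos_unique)
qed

lemma n_diam_unit_ball_ge_1:
  assumes "n \<ge> 2"
  shows "n_diam n (ball 0 1) \<ge> 1"
  using assms by (simp add: n_diam_unit_ball)

lemma trans_diam_unit_ball: "trans_diam (ball 0 1) = 1"
proof -
  have lim: "(\<lambda>n. n_diam n (ball 0 1)) \<longlonglongrightarrow> trans_diam (ball 0 1)"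
    by (rule n_diam_tendsto_trans_diam) auto
  \<comment> \<open>The upper bound of the squeeze comes from m + 1 <= 2 m.\<close>
  have "(\<lambda>m. root m 2 * root m m) \<longlonglongrightarrow> 1 * 1"
    by (intro tendsto_mult LIMSEQ_root LIMSEQ_root_const) auto
  then have 2: "(\<lambda>m. root m 2 * root m m) \<longlonglongrightarrow> 1" by simp
  have "(\<lambda>m. root m (real (m + 1))) \<longlonglongrightarrow> 1"
  proof (rule tendsto_sandwich[OF _ _ tendsto_const 2])
    show "\<forall>\<^sub>F m in sequentially. 1 \<le> root m (real (m + 1))"
      using eventually_gt_at_top[of 0] by eventually_elim auto
    show "\<forall>\<^sub>F m in sequentially. root m (real (m + 1)) \<le> root m 2 * root m (real m)"
      using eventually_gt_at_top[of 0] by eventually_elim (auto simp: real_root_mult[symmetric])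
  qed
  moreover have "\<forall>\<^sub>F m in sequentially. root m (real (m + 1)) = n_diam (m + 1) (ball 0 1)"
    using eventually_gt_at_top[of 0] by eventually_elim (subst n_diam_unit_ball, auto)
  ultimately have "(\<lambda>m. n_diam (m + 1) (ball 0 1)) \<longlonglongrightarrow> 1"
    by (rule Lim_transform_eventually)
  then have "(\<lambda>n. n_diam n (ball 0 1)) \<longlonglongrightarrow> 1" by (rule LIMSEQ_offset)
  then show ?thesis using lim LIMSEQ_unique by blast
qed

subsection \<open>Hadamard's three circles theorem\<close>

text \<open>For real \<alpha> the function z^\<alpha> H(z) is in general multivalued on the annulus
  and only its modulus is well defined. The maximum principle is therefore applied locally, in the
  coordinate \<open>s\<close> with \<open>z = z0 * exp s\<close>, where
  \<open>exp (\<alpha> * s)\<close> is a branch of the power up to a constant.\<close>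

lemma three_circles_weighted:
  fixes \<alpha> :: real
  assumes holH: "H holomorphic_on S" and S: "open S" "\<And>z. r1 \<le> cmod z \<Longrightarrow> cmod z \<le> r2 \<Longrightarrow> z \<in> S"
    and r: "0 < r1" "r1 \<le> r2"
    and 1: "\<And>z. cmod z = r1 \<Longrightarrow> r1 powr \<alpha> * cmod (H z) \<le> B"
    and 2: "\<And>z. cmod z = r2 \<Longrightarrow> r2 powr \<alpha> * cmod (H z) \<le> B"
    and x: "r1 \<le> cmod x" "cmod x \<le> r2"
  shows "cmod x powr \<alpha> * cmod (H x) \<le> B"
proof -
  define A where "A = {z. r1 \<le> cmod z \<and> cmod z \<le> r2}"
  define u where "u = (\<lambda>z. cmod z powr \<alpha> * cmod (H z))"
  have "A = cball 0 r2 - ball 0 r1" by (auto simp: A_def)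
  then have cA: "compact A" by (simp add: compact_diff)
  have AS: "A \<subseteq> S" using S by (auto simp: A_def)
  have contu: "continuous_on A u"
    unfolding u_def using r
    by (intro continuous_intros continuous_on_subset[OF holomorphic_on_imp_continuous_on[OF holH] AS])
       (auto simp: A_def)
  have "x \<in> A" using x by (simp add: A_def)
  then obtain m where m: "m \<in> A" "\<And>z. z \<in> A \<Longrightarrow> u z \<le> u m"
    using continuous_attains_sup[OF cA _ contu] by blast
  define K where "K = {z \<in> A. u z = u m}"
  have "closed K"
    unfolding K_def using contu cA by (intro continuous_closed_preimage_constant compact_imp_closed)
  then have "compact K"
    using compact_Int_closed[OF cA] by (metis (no_types, lifting) Int_absorb1 K_def mem_Collect_eq subsetI)
  moreover have "m \<in> K" using m by (simp add: K_def)
  ultimately obtain z0 where z0: "z0 \<in> K" "\<And>z. z \<in> K \<Longrightarrow> cmod z \<le> cmod z0"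
    using continuous_attains_sup[of K cmod] by (auto intro: continuous_intros)
  have z0A: "z0 \<in> A" "u z0 = u m" using z0 by (auto simp: K_def)
  have z0nz: "cmod z0 > 0" using z0A r by (auto simp: A_def)
  \<comment> \<open>Among the maximum points of \<open>u\<close> take one of largest modulus: if it were an interior
    point, \<open>u\<close> would be constant nearby, giving a maximum point of larger modulus.\<close>
  have "cmod z0 = r1 \<or> cmod z0 = r2"
  proof (rule ccontr)
    assume "\<not> ?thesis"
    then have int: "r1 < cmod z0" "cmod z0 < r2" using z0A by (auto simp: A_def)
    define T where "T = {s. r1 < cmod (z0 * exp s) \<and> cmod (z0 * exp s) < r2}"
    have "open T" unfolding T_def
      by (intro open_Collect_conj open_Collect_less continuous_intros)
    moreover have "0 \<in> T" using int by (simp add: T_def)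
    ultimately obtain d where d: "d > 0" "ball 0 d \<subseteq> T" by (meson openE)
    define g where "g = (\<lambda>s. exp (of_real \<alpha> * s) * H (z0 * exp s))"
    have in_A: "z0 * exp s \<in> A" if "s \<in> ball 0 d" for s
      using d that by (force simp: T_def A_def)
    have gu: "cmod (g s) = u (z0 * exp s) / cmod z0 powr \<alpha>" for s
      using z0nz by (simp add: g_def u_def norm_mult powr_mult exp_powr_real mult.commute)
    have "g constant_on ball 0 d"
    proof (rule maximum_modulus_principle[where \<xi> = 0 and U = "ball 0 d"])
      have "(\<lambda>s. H (z0 * exp s)) holomorphic_on ball 0 d"
        using in_A AS by (intro holomorphic_on_compose_gen[OF _ holH, unfolded o_def] holomorphic_intros) auto
      then show "g holomorphic_on ball 0 d" unfolding g_def by (intro holomorphic_intros)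
      show "cmod (g s) \<le> cmod (g 0)" if "s \<in> ball 0 d" for s
        unfolding gu using m(2)[OF in_A[OF that]] z0A by (simp add: divide_right_mono)
    qed (use d in auto)
    then have "g (of_real (d / 2)) = g 0" using d by (auto simp: constant_on_def)
    then have "u (z0 * exp (of_real (d / 2))) = u z0"
      using gu[of "of_real (d / 2)"] gu[of 0] z0nz by simp
    then have "z0 * exp (of_real (d / 2)) \<in> K"
      using z0A in_A[of "of_real (d / 2)"] d by (auto simp: K_def)
    then have "cmod z0 * exp (d / 2) \<le> cmod z0" using z0(2) by (fastforce simp: norm_mult)
    then show False using z0nz d by (simp add: mult_le_cancel_left1)
  qed
  then have "u z0 \<le> B" using 1 2 by (auto simp: u_def)
  then show ?thesis using m(2)[OF \<open>x \<in> A\<close>] z0A by (simp add: u_def)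
qed

lemma three_circles:
  assumes holH: "H holomorphic_on S" and S: "open S" "\<And>z. r1 \<le> cmod z \<Longrightarrow> cmod z \<le> r2 \<Longrightarrow> z \<in> S"
    and r: "0 < r1" "r1 < r2" and M: "0 < M1" "0 < M2"
    and 1: "\<And>z. cmod z = r1 \<Longrightarrow> cmod (H z) \<le> M1"
    and 2: "\<And>z. cmod z = r2 \<Longrightarrow> cmod (H z) \<le> M2"
    and t: "0 \<le> t" "t \<le> 1" and x: "cmod x = exp ((1 - t) * ln r1 + t * ln r2)"
  shows "cmod (H x) \<le> M1 powr (1 - t) * M2 powr t"
proof -
  \<comment> \<open>This exponent makes the weighted bounds on the two circles equal, with common
    value \<open>exp b\<close>.\<close>
  define \<alpha> where "\<alpha> = (ln M1 - ln M2) / (ln r2 - ln r1)"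
  define b where "b = \<alpha> * ln r1 + ln M1"
  have lnr: "ln r1 < ln r2" using r by simp
  then have b2: "b = \<alpha> * ln r2 + ln M2" by (simp add: b_def \<alpha>_def field_simps)
  have lnx: "ln (cmod x) = (1 - t) * ln r1 + t * ln r2" using x by simp
  have "ln r1 \<le> (1 - t) * ln r1 + t * ln r2" "(1 - t) * ln r1 + t * ln r2 \<le> ln r2"
  proof -
    have "0 \<le> t * (ln r2 - ln r1)" "0 \<le> (1 - t) * (ln r2 - ln r1)"
      using t lnr by (auto intro!: mult_nonneg_nonneg)
    then show "ln r1 \<le> (1 - t) * ln r1 + t * ln r2" "(1 - t) * ln r1 + t * ln r2 \<le> ln r2"
      by (auto simp: algebra_simps)
  qed
  then have xr: "r1 \<le> cmod x" "cmod x \<le> r2"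
    using r unfolding x by (metis exp_le_cancel_iff exp_ln less_trans)+
  have e1: "r1 powr \<alpha> * M1 = exp b" and e2: "r2 powr \<alpha> * M2 = exp b"
  proof -
    show "r1 powr \<alpha> * M1 = exp b" using r M by (simp add: b_def powr_def exp_add)
    show "r2 powr \<alpha> * M2 = exp b" using r M unfolding b2 by (simp add: powr_def exp_add)
  qed
  have "cmod x powr \<alpha> * cmod (H x) \<le> exp b"
  proof (rule three_circles_weighted[OF holH S(1)])
    show "r1 powr \<alpha> * cmod (H z) \<le> exp b" if "cmod z = r1" for z
      using 1[OF that] unfolding e1[symmetric] by (simp add: mult_left_mono)
    show "r2 powr \<alpha> * cmod (H z) \<le> exp b" if "cmod z = r2" for z
      using 2[OF that] unfolding e2[symmetric] by (simp add: mult_left_mono)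
  qed (use r xr S in auto)
  then have "cmod (H x) \<le> exp b / exp (\<alpha> * ln (cmod x))"
    using r xr(1) by (auto simp: powr_def field_simps split: if_splits)
  also have "\<dots> = exp (b - \<alpha> * ln (cmod x))" by (simp add: exp_diff)
  also have "b - \<alpha> * ln (cmod x) = (1 - t) * ln M1 + t * ln M2"
  proof -
    have "b = (1 - t) * b + t * b" by (simp add: algebra_simps)
    also have "\<dots> = (1 - t) * (\<alpha> * ln r1 + ln M1) + t * (\<alpha> * ln r2 + ln M2)"
      using b_def b2 by simp
    finally show ?thesis unfolding lnx by (simp add: algebra_simps)
  qed
  finally show ?thesis using M by (simp add: powr_def exp_add)
qed

subsection \<open>Difference quotients\<close>

definition dslope :: "(complex \<Rightarrow> complex) \<Rightarrow> complex \<Rightarrow> complex" where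
  "dslope f z = (if z = 0 then deriv f 0 else (f z - f 0) / z)"

lemma dslope_0 [simp]: "dslope f 0 = deriv f 0"
  by (simp add: dslope_def)

lemma eq_dslope: "f z = z * dslope f z + f 0"
  by (simp add: dslope_def)

lemma holomorphic_on_dslope:
  assumes "f holomorphic_on S" "0 \<in> interior S"
  shows "dslope f holomorphic_on S"
proof -
  have "dslope f = (\<lambda>z. if z = 0 then deriv f 0 else (f z - f 0) / (z - 0))"
    by (auto simp: dslope_def)
  then show ?thesis using pole_lemma[OF assms] by simp
qed

text \<open>The quotient of the Vandermonde product of the \<open>f (w i * x)\<close> by the power
  of \<open>x\<close> (see \<open>vdm_image_eq\<close>), written so that its value at
  \<open>x = 0\<close> is already the right one and no removable singularity has to be treated for
  the product itself.\<close>

definition vdm_slope :: "(complex \<Rightarrow> complex) \<Rightarrow> nat \<Rightarrow> (nat \<Rightarrow> complex) \<Rightarrow> complex \<Rightarrow> complex" where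
  "vdm_slope f n w x = vdm n (\<lambda>i. w i * dslope f (w i * x))"

lemma vdm_image_eq: "vdm n (\<lambda>i. f (w i * x)) = x ^ (n choose 2) * vdm_slope f n w x"
proof -
  have "vdm n (\<lambda>i. f (w i * x)) = vdm n (\<lambda>i. x * (w i * dslope f (w i * x)) + f 0)"
    using eq_dslope[of f] by (intro vdm_cong) (metis mult.assoc mult.commute)
  then show ?thesis by (simp only: vdm_affine vdm_slope_def)
qed

lemma vdm_slope_0: "vdm_slope f n w 0 = deriv f 0 ^ (n choose 2) * vdm n w"
  using vdm_scale[of n "deriv f 0" w] by (simp add: vdm_slope_def mult.commute)

lemma holomorphic_on_compose_scale:
  assumes "g holomorphic_on ball 0 1" "cmod w \<le> 1"
  shows "(\<lambda>x. g (w * x)) holomorphic_on ball 0 1"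
proof (rule holomorphic_on_compose_gen[where g = g and t = "ball 0 1", unfolded o_def])
  show "(\<lambda>x. w * x) ` ball 0 1 \<subseteq> ball 0 1"
  proof clarsimp
    fix x :: complex assume "cmod x < 1"
    then show "cmod (w * x) < 1"
      using assms(2) mult_left_le_one_le[of "cmod x" "cmod w"] by (simp add: norm_mult)
  qed
qed (use assms in \<open>auto intro!: holomorphic_intros\<close>)

lemma holomorphic_on_vdm_slope:
  assumes "f holomorphic_on ball 0 1" "\<And>i. i < n \<Longrightarrow> cmod (w i) \<le> 1"
  shows "vdm_slope f n w holomorphic_on ball 0 1"
proof -
  have "dslope f holomorphic_on ball 0 1"
    using assms(1) by (rule holomorphic_on_dslope) (simp add: interior_open)
  then have "(\<lambda>x. dslope f (w i * x)) holomorphic_on ball 0 1" if "i < n" for i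
    using assms(2)[OF that] by (rule holomorphic_on_compose_scale)
  then show ?thesis
    unfolding vdm_slope_def vdm_def by (intro holomorphic_intros) auto
qed

lemma norm_le_on_ball_if_norm_le_on_sphere:
  assumes "H holomorphic_on ball 0 1" "0 < s" "s < 1"
    "\<And>z. cmod z = s \<Longrightarrow> cmod (H z) \<le> B" "cmod x \<le> s"
  shows "cmod (H x) \<le> B"
proof (rule maximum_modulus_frontier[where S = "cball 0 s" and f = H and \<xi> = x])
  show "H holomorphic_on interior (cball 0 s)"
    using assms by (auto intro!: holomorphic_on_subset[OF assms(1)])
  show "continuous_on (closure (cball 0 s)) H"
    using assms by (auto intro!: continuous_on_subset[OF holomorphic_on_imp_continuous_on[OF assms(1)]])
  show "bounded (cball 0 s :: complex set)" by simp
  show "x \<in> cball 0 s" using assms by simp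
  show "cmod (H z) \<le> B" if "z \<in> frontier (cball 0 s)" for z
    using that assms by (auto simp: frontier_cball)
qed

lemma image_choose:
  fixes n :: nat
  assumes "\<And>i. i < n \<Longrightarrow> z i \<in> f ` A"
  shows "\<exists>x. \<forall>i<n. x i \<in> A \<and> z i = f (x i)"
  using assms by (intro exI[of _ "\<lambda>i. inv_into A f (z i)"]) (simp add: inv_into_into f_inv_into_f)

section \<open>Growth, bounds and convexity of the n-diameter of image discs\<close>

locale holomorphic_disc =
  fixes f :: "complex \<Rightarrow> complex"
  assumes holf: "f holomorphic_on ball 0 1"
begin

lemma contf: "r < 1 \<Longrightarrow> continuous_on (cball 0 r) f"
  by (rule continuous_on_subset[OF holomorphic_on_imp_continuous_on[OF holf]]) auto

lemma bounded_image: 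
  assumes "r < 1" shows "bounded (f ` ball 0 r)"
proof -
  have "compact (f ` cball 0 r)" using contf[OF assms] by (intro compact_continuous_image) auto
  then show ?thesis by (rule bounded_subset[OF compact_imp_bounded]) auto
qed

lemma image_cball_subset_closure:
  assumes "0 < r" "r < 1" shows "f ` cball 0 r \<subseteq> closure (f ` ball 0 r)"
  using image_closure_subset[of "ball 0 r" f "closure (f ` ball 0 r)"] contf[of r] assms
  by (auto simp: closure_subset)

lemma norm_vdm_image_le:
  assumes "n \<ge> 2" "0 < r" "r < 1" "\<And>i. i < n \<Longrightarrow> cmod (x i) \<le> r"
  shows "cmod (vdm n (\<lambda>i. f (x i))) \<le> n_diam n (f ` ball 0 r) ^ (n choose 2)"
  using assms image_cball_subset_closure[of r]
  by (intro norm_vdm_le_n_diam_closure bounded_image) auto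

lemma norm_vdm_slope_le:
  assumes "n \<ge> 2" "0 < r" "r < 1" "\<And>i. i < n \<Longrightarrow> cmod (w i) \<le> 1" "cmod x = r"
  shows "cmod (vdm_slope f n w x) \<le> (n_diam n (f ` ball 0 r) / r) ^ (n choose 2)"
proof -
  have "cmod (vdm n (\<lambda>i. f (w i * x))) \<le> n_diam n (f ` ball 0 r) ^ (n choose 2)"
    using assms by (intro norm_vdm_image_le) (auto simp: norm_mult mult_left_le_one_le)
  then show ?thesis
    using assms unfolding vdm_image_eq by (simp add: norm_mult norm_power power_divide pos_le_divide_eq mult.commute)
qed

text \<open>Every configuration in the disc of radius \<open>r\<close> has the form
  \<open>w i * r\<close> with \<open>w i\<close> in the closed unit disc. Letting \<open>w\<close>
  vary thus makes it enough to test each slope product at the single point \<open>r\<close>.\<close>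

lemma n_diam_image_le:
  assumes "n \<ge> 2" "0 < r" "M \<ge> 0"
    "\<And>w. (\<And>i. i < n \<Longrightarrow> cmod (w i) \<le> 1) \<Longrightarrow> cmod (vdm_slope f n w (of_real r)) \<le> M ^ (n choose 2)"
  shows "n_diam n (f ` ball 0 r) / r \<le> M"
proof -
  have "n_diam n (f ` ball 0 r) \<le> r * M"
  proof (rule n_diam_le)
    fix z assume "\<And>i. i < n \<Longrightarrow> z i \<in> f ` ball 0 r"
    then have "\<exists>x. \<forall>i<n. x i \<in> ball 0 r \<and> z i = f (x i)" by (rule image_choose)
    then obtain x where "\<forall>i<n. x i \<in> ball 0 r \<and> z i = f (x i)" ..
    then have x: "\<And>i. i < n \<Longrightarrow> cmod (x i) < r \<and> z i = f (x i)" by simp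
    define w where "w = (\<lambda>i. x i / of_real r)"
    have w: "cmod (w i) \<le> 1" if "i < n" for i
      using x[OF that] assms by (simp add: w_def norm_divide)
    have "vdm n z = vdm n (\<lambda>i. f (w i * of_real r))"
      using x assms by (intro vdm_cong) (simp add: w_def)
    then show "cmod (vdm n z) \<le> (r * M) ^ (n choose 2)"
      using assms(4)[OF w] assms
      by (simp add: vdm_image_eq norm_mult norm_power power_mult_distrib mult_left_mono)
  qed (use assms in auto)
  then show ?thesis using assms by (simp add: field_simps)
qed

lemma n_diam_image_nonneg:
  assumes "n \<ge> 2" "0 < r" "r < 1"
  shows "n_diam n (f ` ball 0 r) \<ge> 0"
  using assms by (intro n_diam_nonneg bounded_image) auto

lemma n_diam_image_quotient_mono:
  assumes "n \<ge> 2" "0 < r" "r \<le> s" "s < 1"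
  shows "n_diam n (f ` ball 0 r) / r \<le> n_diam n (f ` ball 0 s) / s"
proof (rule n_diam_image_le)
  show "n_diam n (f ` ball 0 s) / s \<ge> 0"
    using assms by (intro divide_nonneg_nonneg n_diam_image_nonneg) auto
  fix w assume w: "\<And>i. i < n \<Longrightarrow> cmod (w i) \<le> 1"
  show "cmod (vdm_slope f n w (of_real r)) \<le> (n_diam n (f ` ball 0 s) / s) ^ (n choose 2)"
  proof (rule norm_le_on_ball_if_norm_le_on_sphere[where s = s and H = "vdm_slope f n w"])
    show "vdm_slope f n w holomorphic_on ball 0 1" using w by (rule holomorphic_on_vdm_slope[OF holf])
    show "cmod (vdm_slope f n w x) \<le> (n_diam n (f ` ball 0 s) / s) ^ (n choose 2)" if "cmod x = s" for x
      using that assms w by (intro norm_vdm_slope_le) auto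
  qed (use assms in auto)
qed (use assms in auto)

text \<open>The maximum principle at the centre: for Fekete points the slope product at 0 has
  modulus equal to the required power of the left-hand side.\<close>

lemma n_diam_image_quotient_ge:
  assumes "n \<ge> 2" "0 < r" "r < 1"
  shows "cmod (deriv f 0) * n_diam n (ball 0 1) \<le> n_diam n (f ` ball 0 r) / r"
proof -
  obtain z where "fekete n z" using fekete_ex[OF assms(1)] .
  then interpret fekete n z .
  have "cmod (vdm_slope f n z 0) \<le> (n_diam n (f ` ball 0 r) / r) ^ (n choose 2)"
  proof (rule norm_le_on_ball_if_norm_le_on_sphere[where s = r and H = "vdm_slope f n z" and x = 0])
    show "vdm_slope f n z holomorphic_on ball 0 1" using in_disc by (rule holomorphic_on_vdm_slope[OF holf])
    show "cmod (vdm_slope f n z x) \<le> (n_diam n (f ` ball 0 r) / r) ^ (n choose 2)" if "cmod x = r" for x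
      using that assms in_disc by (intro norm_vdm_slope_le) auto
  qed (use assms in auto)
  then have "(cmod (deriv f 0) * n_diam n (ball 0 1)) ^ (n choose 2) \<le> (n_diam n (f ` ball 0 r) / r) ^ (n choose 2)"
    by (simp add: vdm_slope_0 norm_mult norm_power power_mult_distrib n_diam_unit_ball)
  then show ?thesis
    using assms choose_2_pos[OF assms(1)] n_diam_image_nonneg[OF assms] n_diam_nonneg[of n "ball 0 1"]
    by (subst (asm) power_mono_iff) simp_all
qed

text \<open>The disc is convex, so \<open>f\<close> is Lipschitz with constant \<open>L\<close> and
  every factor grows by at most \<open>L\<close>. Together with the lower bound this identifies the
  limit of the quotient at radius 0.\<close>

lemma n_diam_image_quotient_le:
  assumes "n \<ge> 2" "0 < r" "r < 1" "L \<ge> 0" "\<And>z. z \<in> ball 0 r \<Longrightarrow> cmod (deriv f z) \<le> L"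
  shows "n_diam n (f ` ball 0 r) / r \<le> L * n_diam n (ball 0 1)"
proof -
  have lip: "cmod (f x - f y) \<le> L * cmod (x - y)" if "x \<in> ball 0 r" "y \<in> ball 0 r" for x y
  proof (rule field_differentiable_bound[where S = "ball 0 r" and f' = "deriv f"])
    show "(f has_field_derivative deriv f z) (at z within ball 0 r)" if "z \<in> ball 0 r" for z
      using that assms
      by (intro has_field_derivative_at_within[OF holomorphic_derivI[OF holf]]) auto
  qed (use assms that in auto)
  have "n_diam n (f ` ball 0 r) \<le> L * n_diam n (ball 0 r)"
  proof (rule n_diam_le)
    fix z assume "\<And>i. i < n \<Longrightarrow> z i \<in> f ` ball 0 r"
    then have "\<exists>x. \<forall>i<n. x i \<in> ball 0 r \<and> z i = f (x i)" by (rule image_choose)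
    then obtain x where x: "\<forall>i<n. x i \<in> ball 0 r \<and> z i = f (x i)" ..
    have "cmod (vdm n z) \<le> (\<Prod>k<n. \<Prod>j<k. cmod (of_real L * x j - of_real L * x k))"
      unfolding vdm_def prod_norm[symmetric]
    proof (intro prod_mono conjI prod_nonneg norm_ge_zero ballI)
      fix k j assume "k \<in> {..<n}" "j \<in> {..<k}"
      then have "cmod (z j - z k) \<le> L * cmod (x j - x k)" using x lip by auto
      then show "cmod (z j - z k) \<le> cmod (of_real L * x j - of_real L * x k)"
        using assms by (simp add: norm_mult flip: right_diff_distrib)
    qed
    also have "\<dots> = cmod (vdm n (\<lambda>i. of_real L * x i))" by (simp add: vdm_def prod_norm)
    also have "\<dots> \<le> L ^ (n choose 2) * n_diam n (ball 0 r) ^ (n choose 2)"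
      unfolding vdm_scale norm_mult norm_power using assms x
      by (auto intro!: mult_mono norm_vdm_le_n_diam)
    finally show "cmod (vdm n z) \<le> (L * n_diam n (ball 0 r)) ^ (n choose 2)"
      by (simp add: power_mult_distrib)
  qed (use assms n_diam_nonneg[of n "ball 0 r"] in auto)
  then show ?thesis using assms n_diam_ball[of n r 0] by (simp add: field_simps)
qed

text \<open>The three circles theorem bounds \<open>D\<close> by a weighted geometric mean, and
  Young's inequality passes to the arithmetic mean that convexity asks for. The summand
  \<open>e\<close> keeps the bounds on the circles positive when \<open>D\<close> vanishes, as for
  constant \<open>f\<close>.\<close>

lemma n_diam_image_quotient_convex:
  assumes "n \<ge> 2" "0 < r1" "r1 < r2" "r2 < 1" "0 \<le> t" "t \<le> 1"
  defines "D \<equiv> (\<lambda>r. n_diam n (f ` ball 0 r) / r)"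
  shows "D (exp ((1 - t) * ln r1 + t * ln r2)) \<le> (1 - t) * D r1 + t * D r2"
proof (rule field_le_epsilon)
  fix e :: real assume e: "e > 0"
  let ?r = "exp ((1 - t) * ln r1 + t * ln r2)" and ?N = "n choose 2"
  have D: "D r1 \<ge> 0" "D r2 \<ge> 0"
    unfolding D_def using assms by (auto intro!: divide_nonneg_nonneg n_diam_image_nonneg)
  have "D ?r \<le> (D r1 + e) powr (1 - t) * (D r2 + e) powr t"
    unfolding D_def[THEN fun_cong[OF meta_eq_to_obj_eq], of ?r]
  proof (rule n_diam_image_le)
    fix w assume w: "\<And>i. i < n \<Longrightarrow> cmod (w i) \<le> 1"
    have bound: "cmod (vdm_slope f n w z) \<le> (D s + e) ^ ?N" if "cmod z = s" "0 < s" "s < 1" "D s \<ge> 0" for z s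
    proof -
      have "cmod (vdm_slope f n w z) \<le> D s ^ ?N"
        unfolding D_def using assms w that by (intro norm_vdm_slope_le) auto
      also have "\<dots> \<le> (D s + e) ^ ?N" using that e by (intro power_mono) auto
      finally show ?thesis .
    qed
    have "cmod (vdm_slope f n w (of_real ?r)) \<le> ((D r1 + e) ^ ?N) powr (1 - t) * ((D r2 + e) ^ ?N) powr t"
    proof (rule three_circles[OF holomorphic_on_vdm_slope[OF holf w] open_ball, where ?r1.0 = r1 and ?r2.0 = r2])
      show "cmod (vdm_slope f n w z) \<le> (D r1 + e) ^ ?N" if "cmod z = r1" for z
        using that assms(2-4) D by (intro bound) auto
      show "cmod (vdm_slope f n w z) \<le> (D r2 + e) ^ ?N" if "cmod z = r2" for z
        using that assms(2-4) D by (intro bound) auto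
      show "0 < (D r1 + e) ^ ?N" "0 < (D r2 + e) ^ ?N" using D e by (auto intro!: zero_less_power)
    qed (use assms(2-6) in auto)
    also have "\<dots> = ((D r1 + e) powr (1 - t) * (D r2 + e) powr t) ^ ?N"
      using D e by (simp add: power_mult_distrib powr_power powr_powr powr_realpow[symmetric] mult.commute add_nonneg_pos)
    finally show "cmod (vdm_slope f n w (of_real ?r)) \<le> ((D r1 + e) powr (1 - t) * (D r2 + e) powr t) ^ ?N" .
  qed (use assms in auto)
  also have "\<dots> \<le> (1 - t) * (D r1 + e) + t * (D r2 + e)"
    using assms D e by (intro Youngs_inequality_0) auto
  also have "\<dots> = (1 - t) * D r1 + t * D r2 + e" by (simp add: algebra_simps)
  finally show "D ?r \<le> (1 - t) * D r1 + t * D r2 + e" .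
qed

end

subsection \<open>The equality case for the transfinite diameter\<close>

context holomorphic_disc
begin

text \<open>Enlarging the configuration \<open>f (w i * x)\<close> by points \<open>y i\<close> that do not depend on \<open>x\<close>
  keeps the Vandermonde product holomorphic in \<open>x\<close>, so the maximum principle applies.\<close>

lemma n_diam_image_ge_mixed:
  assumes r: "0 < r" "r < 1" and n: "n \<ge> 2"
    and w: "\<And>i. i < n \<Longrightarrow> cmod (w i) \<le> 1" and y: "\<And>i. i < k \<Longrightarrow> y i \<in> f ` ball 0 r"
  shows "(r * cmod (deriv f 0)) ^ (n choose 2) * cmod (vdm n w) * (\<Prod>i<k. cmod (f 0 - y i) ^ n) * cmod (vdm k y)
     \<le> n_diam (n + k) (f ` ball 0 r) ^ ((n + k) choose 2)"
proof -
  let ?N = "n choose 2" and ?D = "n_diam (n + k) (f ` ball 0 r) ^ ((n + k) choose 2)"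
  define H where "H = (\<lambda>x. vdm_slope f n w x * (\<Prod>i<k. \<Prod>j<n. f (w j * x) - y i) * vdm k y)"
  have "cmod (H 0) \<le> ?D / r ^ ?N"
  proof (rule norm_le_on_ball_if_norm_le_on_sphere[where s = r and H = H and x = 0])
    show "H holomorphic_on ball 0 1"
      unfolding H_def
      by (intro holomorphic_intros holomorphic_on_vdm_slope[OF holf] holomorphic_on_compose_scale[OF holf] w) auto
    fix x :: complex assume x: "cmod x = r"
    define p where "p = (\<lambda>i. if i < n then f (w i * x) else y (i - n))"
    have "vdm n p = x ^ ?N * vdm_slope f n w x"
      unfolding vdm_image_eq[symmetric] by (rule vdm_cong) (simp add: p_def)
    then have "vdm (n + k) p = x ^ ?N * H x"
      by (simp add: vdm_add H_def p_def mult_ac)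
    moreover have "cmod (vdm (n + k) p) \<le> ?D"
    proof (rule norm_vdm_le_n_diam_closure)
      fix i assume i: "i < n + k"
      show "p i \<in> closure (f ` ball 0 r)"
      proof (cases "i < n")
        case True
        have "w i * x \<in> cball 0 r" using w[OF True] x r by (simp add: norm_mult mult_left_le_one_le)
        then show ?thesis using image_cball_subset_closure[OF r] True by (auto simp: p_def)
      next
        case False
        then have "p i \<in> f ` ball 0 r" using y[of "i - n"] i by (simp add: p_def)
        then show ?thesis using closure_subset[of "f ` ball 0 r"] by (rule subsetD[rotated])
      qed
    qed (use n bounded_image[OF r(2)] in auto)
    ultimately show "cmod (H x) \<le> ?D / r ^ ?N"
      using r x by (simp add: norm_mult norm_power pos_le_divide_eq mult.commute)
  qed (use r in auto)
  moreover have "cmod (H 0) = cmod (deriv f 0) ^ ?N * cmod (vdm n w) * (\<Prod>i<k. cmod (f 0 - y i) ^ n) * cmod (vdm k y)"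
    by (simp add: H_def vdm_slope_0 norm_mult norm_power prod_norm[symmetric])
  ultimately show ?thesis
    using r by (simp add: pos_le_divide_eq power_mult_distrib mult_ac)
qed

lemma deriv_nonzero_not_constant:
  assumes "deriv f 0 \<noteq> 0" shows "\<not> f constant_on ball 0 1"
proof
  assume "f constant_on ball 0 1"
  then obtain c where "\<And>x. x \<in> ball 0 1 \<Longrightarrow> f x = c" by (auto simp: constant_on_def)
  then have "deriv f 0 = deriv (\<lambda>_. c) 0"
    by (intro deriv_cong_ev refl) (auto simp: eventually_nhds intro!: exI[of _ "ball 0 1"])
  then show False using assms by simp
qed

text \<open>Put \<open>s * k\<close> points on the image of a Fekete configuration and
  \<open>k\<close> points near \<open>y0\<close>. If \<open>y0\<close> is too far from
  \<open>f 0\<close>, the interaction of the two groups gains an amount proportional to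
  \<open>s\<close> over capacity \<open>c\<close>, while crowding the \<open>k\<close> points costs
  an amount independent of \<open>s\<close>. Letting \<open>k\<close> tend to infinity, a large
  \<open>s\<close> contradicts capacity \<open>c\<close>.\<close>

lemma norm_image_diff_le_if_trans_diam_eq:
  assumes r: "0 < r" "r < 1" and f': "deriv f 0 \<noteq> 0"
    and eq: "trans_diam (f ` ball 0 r) = r * cmod (deriv f 0)"
    and y0: "y0 \<in> f ` ball 0 r"
  shows "cmod (y0 - f 0) \<le> r * cmod (deriv f 0)"
proof (rule ccontr)
  define c where "c = r * cmod (deriv f 0)"
  define E where "E = f ` ball 0 r"
  have c: "c > 0" using r f' by (simp add: c_def)
  assume "\<not> ?thesis"
  then have gt: "cmod (y0 - f 0) > c" by (simp add: c_def)
  have "open E"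
    unfolding E_def using r deriv_nonzero_not_constant[OF f']
    by (intro open_mapping_thm[OF holf]) auto
  then obtain d0 where d0: "d0 > 0" "ball y0 d0 \<subseteq> E"
    using y0 by (auto simp: E_def elim!: openE)
  \<comment> \<open>The closed disc of radius \<open>d\<close> around \<open>y0\<close> lies in
    \<open>E\<close>, and its points keep distance at least \<open>b > c\<close> from
    \<open>f 0\<close>, as \<open>d\<close> uses up at most half of the excess.\<close>
  define d where "d = min (d0 / 2) ((cmod (y0 - f 0) - c) / 2)"
  define b where "b = cmod (y0 - f 0) - d"
  have d: "d > 0" "d < d0" using d0 gt by (auto simp: d_def min_def)
  have b: "b > c" using gt unfolding b_def d_def by (simp add: min_def field_simps)
  have step: "real (n choose 2) * ln c + real (n * k) * ln b + real (k choose 2) * ln d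
     \<le> real ((n + k) choose 2) * ln (n_diam (n + k) E)" if nk: "n \<ge> 2" "k \<ge> 2" for n k
  proof -
    obtain w where "fekete n w" using fekete_ex[OF nk(1)] .
    then interpret w: fekete n w .
    obtain u where "fekete k u" using fekete_ex[OF nk(2)] .
    then interpret u: fekete k u .
    have w1: "cmod (vdm n w) \<ge> 1"
      unfolding w.n_diam_unit_ball[symmetric] using n_diam_unit_ball_ge_1[OF nk(1)] by (rule one_le_power)
    have u1: "cmod (vdm k u) \<ge> 1"
      unfolding u.n_diam_unit_ball[symmetric] using n_diam_unit_ball_ge_1[OF nk(2)] by (rule one_le_power)
    define y where "y = (\<lambda>i. of_real d * u i + y0)"
    have dy: "cmod (y i - y0) \<le> d" for i
      using u.in_disc[of i] d by (simp add: y_def norm_mult mult_left_le)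
    have yE: "y i \<in> f ` ball 0 r" for i
    proof -
      have "y i \<in> ball y0 d0" using dy[of i] d by (simp add: dist_norm norm_minus_commute)
      then show ?thesis using d0 by (auto simp: E_def)
    qed
    have yb: "b \<le> cmod (f 0 - y i)" for i
    proof -
      have "cmod (y0 - f 0) \<le> cmod (y0 - y i) + cmod (y i - f 0)"
        using norm_triangle_ineq[of "y0 - y i" "y i - f 0"] by simp
      then show ?thesis using dy[of i] by (simp add: b_def norm_minus_commute)
    qed
    have "c ^ (n choose 2) * b ^ (n * k) * d ^ (k choose 2) =
        c ^ (n choose 2) * 1 * (\<Prod>i<k. b ^ n) * (d ^ (k choose 2) * 1)"
      by (simp add: power_mult)
    also have "\<dots> \<le> c ^ (n choose 2) * cmod (vdm n w) * (\<Prod>i<k. cmod (f 0 - y i) ^ n) * cmod (vdm k y)"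
    proof (intro mult_mono prod_mono conjI)
      show "d ^ (k choose 2) * 1 \<le> cmod (vdm k y)"
        unfolding y_def vdm_affine using d u1 by (simp add: norm_mult norm_power)
      show "b ^ n \<le> cmod (f 0 - y i) ^ n" for i
        using yb[of i] b c by (intro power_mono) auto
    qed (use c b d w1 in \<open>auto intro!: mult_nonneg_nonneg prod_nonneg\<close>)
    also have "\<dots> \<le> n_diam (n + k) E ^ ((n + k) choose 2)"
      unfolding c_def E_def using nk yE w.in_disc by (intro n_diam_image_ge_mixed[OF r]) auto
    finally have le: "c ^ (n choose 2) * b ^ (n * k) * d ^ (k choose 2) \<le> n_diam (n + k) E ^ ((n + k) choose 2)" .
    have pos: "c ^ (n choose 2) * b ^ (n * k) * d ^ (k choose 2) > 0" using c b d by simp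
    have "n_diam (n + k) E \<ge> 0"
      unfolding E_def using nk r by (intro n_diam_image_nonneg) auto
    moreover have "n_diam (n + k) E \<noteq> 0" using le pos nk choose_2_pos[of "n + k"] by (auto simp: zero_power)
    ultimately have D: "n_diam (n + k) E > 0" by simp
    have "ln (c ^ (n choose 2) * b ^ (n * k) * d ^ (k choose 2)) \<le> ln (n_diam (n + k) E ^ ((n + k) choose 2))"
      using le pos by (intro ln_mono) auto
    then show ?thesis using c b d D by (simp add: ln_mult ln_realpow)
  qed
  have lim: "(\<lambda>m. n_diam m E) \<longlonglongrightarrow> c"
    using n_diam_tendsto_trans_diam[OF bounded_image[OF r(2)]] r eq by (simp add: E_def c_def)
  have bound: "2 * real s * (ln b - ln c) \<le> ln c - ln d" if s: "s \<ge> 1" for s :: nat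
  proof -
    have "filterlim (\<lambda>k. s * k + k) at_top at_top"
      by (rule filterlim_at_top_mono[OF filterlim_ident]) auto
    then have "(\<lambda>k. n_diam (s * k + k) E) \<longlonglongrightarrow> c"
      by (rule filterlim_compose[OF lim])
    then have lnlim: "(\<lambda>k. ln (n_diam (s * k + k) E)) \<longlonglongrightarrow> ln c"
      using c by (intro tendsto_ln) auto
    \<comment> \<open>This is the left-hand side of \<open>step\<close> with \<open>s * k\<close> in
      place of \<open>n\<close>, multiplied by \<open>2 / k ^ 2\<close>, where \<open>x\<close>
      stands for \<open>1 / k\<close>.\<close>
    let ?L = "\<lambda>x::real. real s * (real s - x) * ln c + 2 * real s * ln b + (1 - x) * ln d"
    have inv: "(\<lambda>k. inverse (real k)) \<longlonglongrightarrow> 0" by (rule lim_inverse_n)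
    have "?L 0 \<le> (real s + 1) * (real s + 1 - 0) * ln c"
    proof (rule LIMSEQ_le)
      show "(\<lambda>k. ?L (inverse (real k))) \<longlonglongrightarrow> ?L 0"
        by (intro tendsto_intros inv)
      show "(\<lambda>k. (real s + 1) * (real s + 1 - inverse (real k)) * ln (n_diam (s * k + k) E)) \<longlonglongrightarrow>
          (real s + 1) * (real s + 1 - 0) * ln c"
        by (intro tendsto_intros inv lnlim)
      show "\<exists>N. \<forall>k\<ge>N. ?L (inverse (real k)) \<le>
          (real s + 1) * (real s + 1 - inverse (real k)) * ln (n_diam (s * k + k) E)"
      proof (intro exI[of _ 2] allI impI)
        fix k :: nat assume k: "k \<ge> 2"
        then have k0: "real k > 0" by simp
        have "s * k \<ge> 2" using s k by (metis le_trans mult_le_mono1 nat_mult_1)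
        then have "real ((s * k) choose 2) * ln c + real (s * k * k) * ln b + real (k choose 2) * ln d
           \<le> real ((s * k + k) choose 2) * ln (n_diam (s * k + k) E)" using step k by blast
        then have "(real ((s * k) choose 2) * ln c + real (s * k * k) * ln b + real (k choose 2) * ln d) * (2 / real k ^ 2)
           \<le> (real ((s * k + k) choose 2) * ln (n_diam (s * k + k) E)) * (2 / real k ^ 2)"
          by (rule mult_right_mono) simp
        moreover have "(real ((s * k) choose 2) * ln c + real (s * k * k) * ln b + real (k choose 2) * ln d) * (2 / real k ^ 2)
           = ?L (inverse (real k))"
          unfolding real_choose_2 using k0 by (simp add: field_simps power2_eq_square)
        moreover have "(real ((s * k + k) choose 2) * ln (n_diam (s * k + k) E)) * (2 / real k ^ 2) =
           (real s + 1) * (real s + 1 - inverse (real k)) * ln (n_diam (s * k + k) E)"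
          unfolding real_choose_2 using k0 by (simp add: field_simps power2_eq_square)
        ultimately show "?L (inverse (real k)) \<le>
          (real s + 1) * (real s + 1 - inverse (real k)) * ln (n_diam (s * k + k) E)" by simp
      qed
    qed
    then show ?thesis by (simp add: algebra_simps)
  qed
  have lnbc: "ln b - ln c > 0" using b c by simp
  obtain s :: nat where s: "real s > (ln c - ln d) / (2 * (ln b - ln c))"
    using reals_Archimedean2 by blast
  have "2 * real (Suc s) * (ln b - ln c) > ln c - ln d"
    using s lnbc by (simp add: field_simps)
  then show False using bound[of "Suc s"] by simp
qed

lemma is_linear_if_dslope_constant:
  assumes "dslope f constant_on ball 0 1"
  shows "is_linear_fun f (ball 0 1)"
proof -
  obtain c where "\<And>z. z \<in> ball 0 1 \<Longrightarrow> dslope f z = c" using assms by (auto simp: constant_on_def)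
  then have "\<forall>z\<in>ball 0 1. f z = c * z + f 0" using eq_dslope[of f] by (metis mult.commute)
  then show ?thesis unfolding is_linear_fun_def by blast
qed

lemma holomorphic_dslope: "dslope f holomorphic_on ball 0 1"
  using holf by (rule holomorphic_on_dslope) (simp add: interior_open)

text \<open>The bound on the image makes \<open>dslope f\<close> on the circle of radius
  \<open>r\<close> no larger than its value at the centre, so \<open>dslope f\<close> is
  constant.\<close>

lemma is_linear_if_trans_diam_eq:
  assumes r: "0 < r" "r < 1" and f': "deriv f 0 \<noteq> 0"
    and eq: "trans_diam (f ` ball 0 r) = r * cmod (deriv f 0)"
  shows "is_linear_fun f (ball 0 1)"
proof -
  have "cmod (f z - f 0) \<le> r * cmod (deriv f 0)" if "cmod z \<le> r" for z
  proof (rule continuous_on_closure_norm_le[where f = "\<lambda>z. f z - f 0" and s = "ball 0 r"])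
    show "continuous_on (closure (ball 0 r)) (\<lambda>z. f z - f 0)"
      using r contf[of r] by (intro continuous_intros) auto
    show "\<forall>y\<in>ball 0 r. cmod (f y - f 0) \<le> r * cmod (deriv f 0)"
      using norm_image_diff_le_if_trans_diam_eq[OF assms] by blast
  qed (use r that in auto)
  then have sphere: "cmod (dslope f z) \<le> cmod (deriv f 0)" if "cmod z = r" for z
    using that r by (auto simp: dslope_def norm_divide field_simps)
  have "dslope f constant_on ball 0 1"
  proof (rule maximum_modulus_principle[where U = "ball 0 r" and \<xi> = 0])
    show "cmod (dslope f z) \<le> cmod (dslope f 0)" if "z \<in> ball 0 r" for z
    proof (rule norm_le_on_ball_if_norm_le_on_sphere[where s = r and H = "dslope f"])
    qed (use that r sphere holomorphic_dslope in auto)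
  qed (use r holomorphic_dslope in auto)
  then show ?thesis by (rule is_linear_if_dslope_constant)
qed

end

subsection \<open>The equality case for the n-diameter\<close>

text \<open>The right-hand side is the factor produced by a monomial \<open>z ^ (m + 1)\<close> of \<open>f\<close> in the expansion of
  \<open>z f'(z) / (f z - f (u z))\<close>; its real part is positive on the unit circle.\<close>

lemma fejer_kernel_identity:
  fixes u :: complex
  assumes "u \<noteq> 1"
  shows "(\<Sum>a<m. \<Sum>b<Suc a. u ^ b) = ((of_nat m + 1) * (1 - u) - 1 + u ^ (m + 1)) / (1 - u) ^ 2"
proof -
  have geo: "(\<Sum>b<a. u ^ b) = (1 - u ^ a) / (1 - u)" for a
    using assms by (simp add: sum_gp_strict)
  have "(1 - u) ^ 2 * (\<Sum>a<m. \<Sum>b<Suc a. u ^ b) = (of_nat m + 1) * (1 - u) - 1 + u ^ (m + 1)"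
  proof (induction m)
    case (Suc m)
    have "(1 - u) ^ 2 * (\<Sum>b<Suc m. u ^ b) = (1 - u) * (1 - u ^ Suc m)"
      unfolding geo using assms by (simp add: power2_eq_square)
    then have "(1 - u) ^ 2 * (\<Sum>a<Suc m. \<Sum>b<Suc a. u ^ b) = 
       (of_nat m + 1) * (1 - u) - 1 + u ^ (m + 1) + (1 - u) * (1 - u ^ Suc m)"
      unfolding sum.lessThan_Suc[of _ m] distrib_left Suc.IH by simp
    also have "\<dots> = (of_nat (Suc m) + 1) * (1 - u) - 1 + u ^ (Suc m + 1)"
      by (simp add: algebra_simps)
    finally show ?case .
  qed simp
  then show ?thesis using assms by (simp add: field_simps)
qed

text \<open>The squared modulus makes the lower bound m / 2 for the real part visible. The induction
  expands the square of \<open>1 + u * S\<close>, using that \<open>u\<close> has modulus 1.\<close>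

lemma Re_fejer_kernel:
  assumes "cmod u = 1"
  shows "2 * Re (\<Sum>a<m. \<Sum>b<Suc a. u ^ b) = real m + cmod (\<Sum>b<m. u ^ b) ^ 2"
proof (induction m)
  case (Suc m)
  define S where "S = (\<Sum>b<m. u ^ b)"
  have e1: "(\<Sum>b<Suc m. u ^ b) = 1 + u * S"
    unfolding S_def sum_distrib_left sum.lessThan_Suc_shift by simp
  have e2: "cmod (1 + u * S) ^ 2 = 2 * Re (1 + u * S) - 1 + cmod S ^ 2"
  proof -
    have "cmod (1 + u * S) ^ 2 = 1 + 2 * Re (u * S) + cmod (u * S) ^ 2"
      unfolding cmod_power2 by (simp add: power2_eq_square algebra_simps)
    then show ?thesis using assms by (simp add: norm_mult)
  qed
  have "2 * Re (\<Sum>a<Suc m. \<Sum>b<Suc a. u ^ b) = 2 * Re (\<Sum>a<m. \<Sum>b<Suc a. u ^ b) + 2 * Re (\<Sum>b<Suc m. u ^ b)"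
    by (subst sum.lessThan_Suc) (simp only: plus_complex.sel distrib_left)
  also have "\<dots> = real (Suc m) + cmod (\<Sum>b<Suc m. u ^ b) ^ 2"
    unfolding e1 e2 Suc.IH S_def[symmetric] by simp
  finally show ?case .
qed simp

text \<open>A nonconstant \<open>a\<close> would have an open image, and no nonempty open set lies
  in the real line.\<close>

lemma holomorphic_real_valued_constant:
  assumes "a holomorphic_on S" "open S" "connected S" "\<And>x. x \<in> S \<Longrightarrow> Im (a x) = 0"
  shows "a constant_on S"
proof (rule ccontr)
  assume nc: "\<not> a constant_on S"
  then have "open (a ` S)" using assms by (intro open_mapping_thm[of a S S]) auto
  moreover obtain x where x: "x \<in> S" using nc by (auto simp: constant_on_def)
  ultimately obtain e where e: "e > 0" "ball (a x) e \<subseteq> a ` S" by (meson imageI openE)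
  have "a x + \<i> * of_real (e / 2) \<in> ball (a x) e" using e by (simp add: dist_norm norm_mult)
  then obtain x' where "x' \<in> S" "a x' = a x + \<i> * of_real (e / 2)" using e by (metis (no_types) imageE subsetD)
  then have "Im (a x + \<i> * of_real (e / 2)) = 0" using assms(4) by metis
  then show False using assms(4)[OF x] e by simp
qed

context holomorphic_disc
begin

lemma is_linear_if_n_diam_eq:
  assumes n: "n \<ge> 2" and s: "0 < s" "s < 1" and f': "deriv f 0 \<noteq> 0"
    and eq: "\<And>r. 0 < r \<Longrightarrow> r < s \<Longrightarrow> n_diam n (f ` ball 0 r) = r * (cmod (deriv f 0) * n_diam n (ball 0 1))"
  shows "is_linear_fun f (ball 0 1)"
proof (rule ccontr)
  let ?N = "n choose 2" and ?c = "deriv f 0" and ?d = "n_diam n (ball 0 1)"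
  assume nonlin: "\<not> is_linear_fun f (ball 0 1)"
  obtain z where "fekete n z" using fekete_ex[OF n] .
  then interpret fekete n z .
  have H0: "cmod (vdm_slope f n z 0) = (cmod ?c * ?d) ^ ?N"
    by (simp add: vdm_slope_0 norm_mult norm_power power_mult_distrib n_diam_unit_ball)
  \<comment> \<open>By \<open>eq\<close> the bound for the slope product is the same at all small
    radii and is attained at the centre.\<close>
  have "vdm_slope f n z constant_on ball 0 1"
  proof (rule maximum_modulus_principle[where U = "ball 0 s" and \<xi> = 0])
    show "vdm_slope f n z holomorphic_on ball 0 1" using in_disc by (rule holomorphic_on_vdm_slope[OF holf])
    show "cmod (vdm_slope f n z x) \<le> cmod (vdm_slope f n z 0)" if "x \<in> ball 0 s" for x
    proof (cases "x = 0")
      case False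
      then have "cmod (vdm_slope f n z x) \<le> (n_diam n (f ` ball 0 (cmod x)) / cmod x) ^ ?N"
        using that s n in_disc by (intro norm_vdm_slope_le) auto
      then show ?thesis unfolding H0 using eq[of "cmod x"] False that by simp
    qed simp
  qed (use s in auto)
  then have Hconst: "vdm_slope f n z x = vdm_slope f n z 0" if "x \<in> ball 0 1" for x
    using that unfolding constant_on_def by (metis centre_in_ball zero_less_one)
  have vdm_eq: "cmod (vdm n (\<lambda>i. f (z i * x))) = n_diam n (f ` ball 0 (cmod x)) ^ ?N"
    if "x \<noteq> 0" "cmod x < s" for x
    using that s eq[of "cmod x"] Hconst[of x] H0
    by (simp add: vdm_image_eq norm_mult norm_power power_mult_distrib)
  have dpos: "?d > 0" using n_diam_unit_ball_ge_1[OF n] by simp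
  define A where "A = {..<n} - {0}"
  have "1 \<in> A" using n by (simp add: A_def)
  then have A: "finite A" "A \<noteq> {}" by (auto simp: A_def)
  define u where "u = (\<lambda>k. z k / z 0)"
  have z0: "cmod (z 0) = 1" using n by (intro norm_eq_1) auto
  then have z0nz: "z 0 \<noteq> 0" by auto
  have u: "cmod (u k) = 1" "u k \<noteq> 1" if "k \<in> A" for k
    using that n inj_onD[OF distinct, of k 0] norm_eq_1[of k] z0 by (auto simp: u_def A_def norm_divide)
  define q where "q = (\<lambda>k x. dslope f x - u k * dslope f (u k * x))"
  have fq: "f x - f (u k * x) = x * q k x" for k x
    unfolding q_def using eq_dslope[of f x] eq_dslope[of f "u k * x"] by (simp add: algebra_simps)
  have q0: "q k 0 = ?c * (1 - u k)" for k by (simp add: q_def algebra_simps)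
  have main: "(\<forall>k\<in>A. q k x \<noteq> 0) \<and> Im (\<Sum>k\<in>A. deriv f x / q k x) = 0" if x: "x \<noteq> 0" "cmod x < s" for x
  proof -
    \<comment> \<open>With this scaling the configuration \<open>z i * y\<close> has its point of
      index 0 at \<open>x\<close> and the others at \<open>u k * x\<close>. Its image is extremal,
      so moving the point of index 0 along the circle cannot increase the Vandermonde
      modulus.\<close>
    define y where "y = x / z 0"
    have y: "y \<noteq> 0" "cmod y = cmod x" "z 0 * y = x" using x z0 z0nz by (auto simp: y_def norm_divide)
    have zy: "z k * y = u k * x" for k using z0nz by (simp add: u_def y_def)
    define p where "p = (\<lambda>i. f (z i * y))"
    have vp: "cmod (vdm n p) = n_diam n (f ` ball 0 (cmod x)) ^ ?N"
      unfolding p_def using vdm_eq[of y] y x by simp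
    have "n_diam n (f ` ball 0 (cmod x)) > 0" using eq[of "cmod x"] x f' dpos by simp
    then have vnz: "vdm n p \<noteq> 0" using vp by auto
    have p0: "p 0 = f x" by (simp add: p_def y)
    have pk: "p k = f (u k * x)" for k by (simp add: p_def zy)
    have nz: "f x - p k \<noteq> 0" if "k \<in> A" for k
      using inj_onD[OF vnz[unfolded vdm_nonzero_iff], of k 0] that n p0 by (auto simp: A_def)
    have der: "(f has_field_derivative deriv f x) (at x)"
      using x s by (intro holomorphic_derivI[OF holf]) auto
    define G where "G = (\<lambda>w. \<Prod>k\<in>A. f w - p k)"
    have G': "(G has_field_derivative G x * (\<Sum>k\<in>A. deriv f x / (f x - p k))) (at x)"
      unfolding G_def using nz der A
      by (intro has_field_derivative_prod_log) (auto intro!: derivative_eq_intros)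
    have Gnz: "G x \<noteq> 0" unfolding G_def using nz A by simp
    have "Im (x * (G x * (\<Sum>k\<in>A. deriv f x / (f x - p k))) / G x) = 0"
    proof (rule Im_log_derivative_eq_0_at_max[OF G' Gnz])
      fix w assume w: "cmod w = cmod x"
      have "cmod (vdm n (p(0 := f w))) \<le> cmod (vdm n p)"
      proof -
        have "p(0 := f w) = (\<lambda>i. f (((\<lambda>i. z i * y)(0 := w)) i))" by (auto simp: p_def)
        then show ?thesis unfolding vp
          using norm_vdm_image_le[of n "cmod x" "(\<lambda>i. z i * y)(0 := w)"] n x s w y in_disc
          by (simp add: norm_mult mult_left_le_one_le)
      qed
      then have "cmod (\<Prod>k\<in>{..<n} - {0}. f w - p k) \<le> cmod (\<Prod>k\<in>{..<n} - {0}. p 0 - p k)"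
        using n vnz by (intro norm_prod_diff_le_if_vdm_le) auto
      then show "cmod (G w) \<le> cmod (G x)" by (simp add: G_def A_def p0)
    qed
    moreover have "x * (G x * (\<Sum>k\<in>A. deriv f x / (f x - p k))) / G x = (\<Sum>k\<in>A. deriv f x / q k x)"
    proof -
      have "x * (\<Sum>k\<in>A. deriv f x / (f x - p k)) = (\<Sum>k\<in>A. deriv f x / q k x)"
        unfolding sum_distrib_left pk fq using x by (intro sum.cong refl) simp
      then show ?thesis using Gnz by simp
    qed
    moreover have "q k x \<noteq> 0" if "k \<in> A" for k
      using nz[OF that] fq[of x k] by (auto simp: pk)
    ultimately show ?thesis by auto
  qed
  have qnz: "q k x \<noteq> 0" if "k \<in> A" "x \<in> ball 0 s" for k x
  proof (cases "x = 0")
    case True then show ?thesis using q0 f' u[OF that(1)] by simp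
  next
    case False then show ?thesis using main that by simp
  qed
  define a where "a = (\<lambda>x. \<Sum>k\<in>A. deriv f x / q k x)"
  have holq: "q k holomorphic_on ball 0 1" if "k \<in> A" for k
    unfolding q_def using u[OF that]
    by (intro holomorphic_intros holomorphic_dslope holomorphic_on_compose_scale) auto
  have a0: "a 0 = (\<Sum>k\<in>A. 1 / (1 - u k))"
    unfolding a_def q0 using f' by (intro sum.cong refl) simp
  have "a 0 = of_real ((real n - 1) / 2)"
  proof -
    have "a 0 = (\<Sum>k\<in>A. z 0 / (z 0 - z k))"
      unfolding a0 using z0nz by (intro sum.cong refl) (simp add: u_def field_simps)
    then show ?thesis using sum_quotients[of 0] n by (simp add: A_def)
  qed
  \<comment> \<open>The stationarity condition covers nonzero \<open>x\<close> only; at 0 the value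
    comes from the Fekete points of the disc.\<close>
  then have Im0: "Im (a 0) = 0" by (simp only: Im_complex_of_real)
  have "a constant_on ball 0 s"
  proof (rule holomorphic_real_valued_constant)
    show "a holomorphic_on ball 0 s"
      unfolding a_def using qnz s holf
      by (intro holomorphic_intros holomorphic_on_subset[of _ "ball 0 1" "ball 0 s"] holq) auto
    show "Im (a x) = 0" if "x \<in> ball 0 s" for x
      using main[of x] Im0 that by (cases "x = 0") (auto simp: a_def)
  qed auto
  then have aconst: "a x = a 0" if "x \<in> ball 0 s" for x
    using that s unfolding constant_on_def by (metis centre_in_ball)
  define k0 where "k0 = (\<lambda>x. dslope f x - ?c)"
  have nc: "\<not> k0 constant_on ball 0 1"
  proof
    assume "k0 constant_on ball 0 1"
    then obtain b where "\<And>x. x \<in> ball 0 1 \<Longrightarrow> dslope f x = b + ?c"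
      unfolding constant_on_def k0_def by (metis diff_add_cancel)
    then have "dslope f constant_on ball 0 1" unfolding constant_on_def by blast
    then show False using nonlin is_linear_if_dslope_constant by blast
  qed
  have hk: "k0 holomorphic_on ball 0 1" unfolding k0_def by (intro holomorphic_intros holomorphic_dslope)
  have k00: "k0 0 = 0" by (simp add: k0_def)
  \<comment> \<open>The first nonlinear term of \<open>f\<close> is
    \<open>h 0 * x ^ (m + 1)\<close>, with \<open>h 0\<close> nonzero.\<close>
  obtain h \<rho> m where m: "0 < m" and \<rho>: "0 < \<rho>" "ball (0::complex) \<rho> \<subseteq> ball 0 1"
    and holh: "h holomorphic_on ball 0 \<rho>" and k0: "\<And>w. w \<in> ball 0 \<rho> \<Longrightarrow> k0 w = (w - 0) ^ m * h w"
    and hnz: "\<And>w. w \<in> ball 0 \<rho> \<Longrightarrow> h w \<noteq> 0"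
  proof (rule holomorphic_factor_zero_nonconstant[OF hk open_ball connected_ball _ k00 nc])
    show "(0::complex) \<in> ball 0 1" by simp
  qed (rule that)
  have slope: "dslope f x = ?c + x ^ m * h x" if "x \<in> ball 0 \<rho>" for x
    using k0[OF that] by (simp add: k0_def algebra_simps)
  have derf: "deriv f x = ?c + x ^ m * (of_nat (m + 1) * h x + x * deriv h x)" if x: "x \<in> ball 0 \<rho>" for x
  proof (rule DERIV_imp_deriv)
    have "(h has_field_derivative deriv h x) (at x)"
      using x by (intro holomorphic_derivI[OF holh]) auto
    then have "((\<lambda>x. ?c * x + x ^ (m + 1) * h x + f 0) has_field_derivative
        ?c + x ^ m * (of_nat (m + 1) * h x + x * deriv h x)) (at x)"
      using power_minus_mult[OF m, of x] by (auto intro!: derivative_eq_intros simp: algebra_simps)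
    then show "(f has_field_derivative ?c + x ^ m * (of_nat (m + 1) * h x + x * deriv h x)) (at x)"
    proof (rule has_field_derivative_transform_within_open[where S = "ball 0 \<rho>"])
      show "?c * w + w ^ (m + 1) * h w + f 0 = f w" if "w \<in> ball 0 \<rho>" for w
        using eq_dslope[of f w] slope[OF that] by (simp add: algebra_simps)
    qed (use x in auto)
  qed
  \<comment> \<open>\<open>x ^ m * B k x\<close> is the numerator of
    \<open>deriv f x / q k x - 1 / (1 - u k)\<close>, the deviation of a summand of \<open>a\<close>
    from its value at 0. Hence \<open>C\<close> is \<open>(a x - a 0) / x ^ m\<close> away from 0.
    It vanishes there, and by continuity also at 0, where it is the coefficient to be
    computed.\<close>
  define B where "B = (\<lambda>k x. (of_nat (m + 1) * h x + x * deriv h x) * (1 - u k) - h x + u k ^ (m + 1) * h (u k * x))"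
  define C where "C = (\<lambda>x. \<Sum>k\<in>A. B k x / (q k x * (1 - u k)))"
  define t where "t = min s \<rho>"
  have t: "t > 0" "t \<le> s" "t \<le> \<rho>" using s \<rho> by (auto simp: t_def)
  have ux: "u k * x \<in> ball 0 \<rho>" if "k \<in> A" "x \<in> ball 0 \<rho>" for k x
    using u[OF that(1)] that(2) by (simp add: norm_mult)
  have C0: "C x = 0" if x: "x \<in> ball 0 t" "x \<noteq> 0" for x
  proof -
    have x': "x \<in> ball 0 \<rho>" "x \<in> ball 0 s" using x t by auto
    have "x ^ m * C x = (\<Sum>k\<in>A. deriv f x / q k x - 1 / (1 - u k))"
      unfolding C_def sum_distrib_left
    proof (rule sum.cong[OF refl])
      fix k assume k: "k \<in> A"
      have qk: "q k x = ?c * (1 - u k) + x ^ m * (h x - u k ^ (m + 1) * h (u k * x))"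
        unfolding q_def slope[OF x'(1)] slope[OF ux[OF k x'(1)]] by (simp add: algebra_simps power_mult_distrib)
      have "x ^ m * B k x = deriv f x * (1 - u k) - q k x"
        unfolding qk derf[OF x'(1)] B_def by (simp add: algebra_simps)
      then have "x ^ m * (B k x / (q k x * (1 - u k))) = (deriv f x * (1 - u k) - q k x) / (q k x * (1 - u k))"
        by simp
      also have "\<dots> = deriv f x / q k x - 1 / (1 - u k)"
        using qnz[OF k x'(2)] u[OF k] by (simp add: field_simps)
      finally show "x ^ m * (B k x / (q k x * (1 - u k))) = deriv f x / q k x - 1 / (1 - u k)" .
    qed
    also have "\<dots> = a x - a 0" unfolding a0 by (simp add: a_def sum_subtractf)
    finally show ?thesis using aconst[OF x'(2)] x by simp
  qed
  have "isCont C 0"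
  proof -
    have "isCont h 0" "isCont (deriv h) 0"
      using \<rho> holh holomorphic_deriv[OF holh]
      by (auto intro!: continuous_on_interior[of "ball 0 \<rho>"] holomorphic_on_imp_continuous_on simp: interior_open)
    moreover have "isCont (\<lambda>x. h (u k * x)) 0" for k
      by (rule isCont_o2[where g = h]) (use \<open>isCont h 0\<close> in auto)
    moreover have "isCont (q k) 0" if "k \<in> A" for k
      using holq[OF that] by (auto intro!: continuous_on_interior[of "ball 0 1"] holomorphic_on_imp_continuous_on simp: interior_open)
    ultimately show ?thesis
      unfolding C_def B_def using qnz u s by (intro continuous_intros) auto
  qed
  then have "C \<midarrow>0\<rightarrow> C 0" by (simp add: isCont_def)
  moreover have "C \<midarrow>0\<rightarrow> 0"
  proof (rule tendsto_eventually)
    show "\<forall>\<^sub>F x in at 0. C x = 0"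
      unfolding eventually_at using t C0 by (intro exI[of _ t]) (auto simp: dist_norm)
  qed
  ultimately have "C 0 = 0" using LIM_unique by blast
  moreover have "C 0 = h 0 / ?c * (\<Sum>k\<in>A. \<Sum>a<m. \<Sum>b<Suc a. u k ^ b)"
    unfolding C_def sum_distrib_left[of _ _ A]
  proof (rule sum.cong[OF refl])
    fix k assume k: "k \<in> A"
    have "B k 0 = h 0 * ((of_nat m + 1) * (1 - u k) - 1 + u k ^ (m + 1))"
      by (simp add: B_def algebra_simps)
    then show "B k 0 / (q k 0 * (1 - u k)) = h 0 / ?c * (\<Sum>a<m. \<Sum>b<Suc a. u k ^ b)"
      unfolding fejer_kernel_identity[OF u(2)[OF k]] q0
      by (simp add: power2_eq_square mult.assoc)
  qed
  ultimately have "(\<Sum>k\<in>A. \<Sum>a<m. \<Sum>b<Suc a. u k ^ b) = 0" using f' hnz[of 0] \<rho> by simp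
  then have "Re (\<Sum>k\<in>A. \<Sum>a<m. \<Sum>b<Suc a. u k ^ b) = 0" by (simp only: zero_complex.sel)
  moreover have "Re (\<Sum>k\<in>A. \<Sum>a<m. \<Sum>b<Suc a. u k ^ b) > 0"
    unfolding Re_sum[of _ A]
  proof (rule sum_pos)
    fix k assume "k \<in> A"
    then have "2 * Re (\<Sum>a<m. \<Sum>b<Suc a. u k ^ b) \<ge> real m"
      using Re_fejer_kernel[OF u(1), of k m] by (simp only: le_add_same_cancel1 zero_le_power2)
    moreover have "real m > 0" using m by simp
    ultimately show "Re (\<Sum>a<m. \<Sum>b<Suc a. u k ^ b) > 0" by linarith
  qed (use A in auto)
  ultimately show False by simp
qed

end

subsection \<open>Convex functions of the logarithm\<close>

lemma log_convex_on_unit_intervalI: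
  assumes "\<And>t r1 r2. 0 < t \<Longrightarrow> t < 1 \<Longrightarrow> 0 < r1 \<Longrightarrow> r1 < r2 \<Longrightarrow> r2 < 1 \<Longrightarrow>
     g (exp ((1 - t) * ln r1 + t * ln r2)) \<le> (1 - t) * g r1 + t * g r2"
  shows "log_convex_on {0<..<1} g"
proof -
  have eq: "ln ` {0<..<1::real} = {..<0}"
  proof (intro equalityI subsetI)
    fix x :: real assume "x \<in> {..<0}"
    then have "exp x \<in> {0<..<1}" "x = ln (exp x)" by auto
    then show "x \<in> ln ` {0<..<1}" by blast
  qed auto
  have "convex_on {..<0} (\<lambda>t. g (exp t))"
  proof (rule convex_on_linorderI)
    fix t x y :: real assume "0 < t" "t < 1" "x \<in> {..<0}" "y \<in> {..<0}" "x < y"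
    then show "g (exp ((1 - t) *\<^sub>R x + t *\<^sub>R y)) \<le> (1 - t) * g (exp x) + t * g (exp y)"
      using assms[of t "exp x" "exp y"] by simp
  qed simp
  then show ?thesis unfolding log_convex_on_def eq .
qed

lemma not_strict_mono_on_if_constant:
  assumes "\<And>r. 0 < r \<Longrightarrow> r < 1 \<Longrightarrow> g r = (c::real)"
  shows "\<not> strict_mono_on {0<..<1::real} g"
proof
  assume "strict_mono_on {0<..<1} g"
  then have "g (1/3) < g (1/2)" by (rule strict_mono_onD) auto
  then show False using assms[of "1/3"] assms[of "1/2"] by simp
qed

text \<open>Suppose \<open>g r = g s\<close> with \<open>r < s\<close>. For \<open>x < r\<close> the
  point \<open>ln r\<close> lies between \<open>ln x\<close> and \<open>ln s\<close>, so convexity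
  gives \<open>g r <= g x\<close>, and monotonicity gives the converse.\<close>

lemma log_convex_constant_if_not_strict:
  assumes mono: "mono_on {0<..<1} g" and conv: "log_convex_on {0<..<1} g"
    and nstrict: "\<not> strict_mono_on {0<..<1} g"
  obtains s where "0 < s" "s < 1" "\<And>x. 0 < x \<Longrightarrow> x \<le> s \<Longrightarrow> g x = g s"
proof -
  obtain r s where rs: "0 < r" "r < s" "s < 1" and ge: "g s \<le> g r"
    using nstrict unfolding strict_mono_on_def by (auto simp: not_less)
  then have eq: "g s = g r" using mono_onD[OF mono, of r s] by auto
  have const: "g x = g r" if x: "0 < x" "x \<le> r" for x
  proof (cases "x = r")
    case False
    then have xr: "x < r" using x by simp
    \<comment> \<open>The weight that expresses \<open>ln r\<close> as a convex combination of
      \<open>ln x\<close> and \<open>ln s\<close>.\<close>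
    define t where "t = (ln r - ln x) / (ln s - ln x)"
    have ln: "ln x < ln r" "ln r < ln s" using x xr rs by auto
    then have t: "0 \<le> t" "t < 1" by (auto simp: t_def field_simps)
    have "t * (ln s - ln x) = ln r - ln x" using ln by (simp add: t_def)
    then have lnr: "(1 - t) * ln x + t * ln s = ln r" by (simp add: algebra_simps)
    have "g (exp ((1 - t) *\<^sub>R ln x + t *\<^sub>R ln s)) \<le> (1 - t) * g (exp (ln x)) + t * g (exp (ln s))"
      using conv t x xr rs unfolding log_convex_on_def by (intro convex_onD[of "ln ` {0<..<1}"]) auto
    then have "g r \<le> (1 - t) * g x + t * g s" using lnr x rs by simp
    then have "(1 - t) * g r \<le> (1 - t) * g x" using eq by (simp add: algebra_simps)
    then have "g r \<le> g x" using t by simp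
    then show ?thesis using mono_onD[OF mono, of x r] x xr rs by simp
  qed simp
  show thesis
  proof (rule that[of r])
    show "0 < r" "r < 1" using rs by auto
  qed (rule const)
qed

subsection \<open>The normalised quotients\<close>

lemma trans_diam_ball:
  assumes "r > 0"
  shows "trans_diam (ball 0 r) = r"
proof -
  have "(\<lambda>n. r * n_diam n (ball 0 1)) \<longlonglongrightarrow> r * 1"
    using n_diam_tendsto_trans_diam[of "ball 0 1"] by (intro tendsto_intros) (simp add: trans_diam_unit_ball)
  moreover have "\<forall>\<^sub>F n in sequentially. r * n_diam n (ball 0 1) = n_diam n (ball 0 r)"
    using eventually_ge_at_top[of 2] by eventually_elim (simp add: n_diam_ball[OF _ assms])
  ultimately have "(\<lambda>n. n_diam n (ball 0 r)) \<longlonglongrightarrow> r"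
    using Lim_transform_eventually by fastforce
  then show ?thesis
    using LIMSEQ_unique n_diam_tendsto_trans_diam[of "ball 0 r"] assms by auto
qed

context holomorphic_disc
begin

text \<open>Carries every non-strict inequality for \<open>phi_ndiam\<close> over to
  \<open>phi_cap\<close>.\<close>

lemma phi_ndiam_tendsto_phi_cap:
  assumes "0 < r" "r < 1"
  shows "(\<lambda>n. phi_ndiam n f r) \<longlonglongrightarrow> phi_cap f r"
proof -
  have "(\<lambda>n. n_diam n (f ` ball 0 r)) \<longlonglongrightarrow> trans_diam (f ` ball 0 r)"
    using assms by (intro n_diam_tendsto_trans_diam bounded_image) auto
  moreover have "(\<lambda>n. n_diam n (ball 0 1)) \<longlonglongrightarrow> 1"
    using n_diam_tendsto_trans_diam[of "ball 0 1"] by (simp add: trans_diam_unit_ball)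
  ultimately have "(\<lambda>n. phi_ndiam n f r) \<longlonglongrightarrow> trans_diam (f ` ball 0 r) / (1 * r)"
    unfolding phi_ndiam_def using assms by (intro tendsto_intros) auto
  then show ?thesis using assms by (simp add: phi_cap_def trans_diam_ball)
qed

lemma phi_ndiam_eq: "phi_ndiam n f r = n_diam n (f ` ball 0 r) / r / n_diam n (ball 0 1)"
  by (simp add: phi_ndiam_def)

lemma phi_ndiam_mono:
  assumes "n \<ge> 2" "0 < r" "r \<le> s" "s < 1"
  shows "phi_ndiam n f r \<le> phi_ndiam n f s"
  unfolding phi_ndiam_eq using n_diam_image_quotient_mono[OF assms] n_diam_unit_ball_ge_1[OF assms(1)]
  by (intro divide_right_mono) auto

lemma phi_ndiam_convex:
  assumes "n \<ge> 2" "0 < r1" "r1 < r2" "r2 < 1" "0 \<le> t" "t \<le> 1"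
  shows "phi_ndiam n f (exp ((1 - t) * ln r1 + t * ln r2)) \<le> (1 - t) * phi_ndiam n f r1 + t * phi_ndiam n f r2"
proof -
  have "phi_ndiam n f (exp ((1 - t) * ln r1 + t * ln r2)) \<le>
     ((1 - t) * (n_diam n (f ` ball 0 r1) / r1) + t * (n_diam n (f ` ball 0 r2) / r2)) / n_diam n (ball 0 1)"
    unfolding phi_ndiam_eq using n_diam_image_quotient_convex[OF assms] n_diam_unit_ball_ge_1[OF assms(1)]
    by (intro divide_right_mono) auto
  then show ?thesis by (simp add: phi_ndiam_eq add_divide_distrib)
qed

lemma phi_ndiam_ge:
  assumes "n \<ge> 2" "0 < r" "r < 1"
  shows "cmod (deriv f 0) \<le> phi_ndiam n f r"
  unfolding phi_ndiam_eq using n_diam_image_quotient_ge[OF assms] n_diam_unit_ball_ge_1[OF assms(1)]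
  by (subst pos_le_divide_eq) auto

lemma phi_ndiam_le:
  assumes "n \<ge> 2" "0 < r" "r < 1" "L \<ge> 0" "\<And>z. z \<in> ball 0 r \<Longrightarrow> cmod (deriv f z) \<le> L"
  shows "phi_ndiam n f r \<le> L"
  unfolding phi_ndiam_eq using n_diam_image_quotient_le[OF assms] n_diam_unit_ball_ge_1[OF assms(1)]
  by (subst pos_divide_le_eq) auto

lemma phi_cap_le_if:
  assumes "0 < r" "r < 1" "\<And>n. n \<ge> 2 \<Longrightarrow> phi_ndiam n f r \<le> L"
  shows "phi_cap f r \<le> L"
  using phi_ndiam_tendsto_phi_cap[OF assms(1,2)] by (rule LIMSEQ_le_const2) (use assms in auto)

lemma phi_cap_ge_if:
  assumes "0 < r" "r < 1" "\<And>n. n \<ge> 2 \<Longrightarrow> L \<le> phi_ndiam n f r"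
  shows "L \<le> phi_cap f r"
  using phi_ndiam_tendsto_phi_cap[OF assms(1,2)] by (rule LIMSEQ_le_const) (use assms in auto)

section \<open>The quotients near radius 0\<close>

lemma deriv_small_radius:
  assumes "e > 0"
  obtains r where "0 < r" "r < 1" "\<And>z. z \<in> ball 0 r \<Longrightarrow> cmod (deriv f z) \<le> cmod (deriv f 0) + e"
proof -
  have "isCont (deriv f) 0"
    using holomorphic_deriv[OF holf]
    by (auto intro!: continuous_on_interior[of "ball 0 1"] holomorphic_on_imp_continuous_on simp: interior_open)
  then obtain d where d: "d > 0" "\<And>z. dist z 0 < d \<Longrightarrow> dist (deriv f z) (deriv f 0) < e"
    using assms unfolding continuous_at_eps_delta by blast
  show thesis
  proof
    show "0 < min d (1/2)" "min d (1/2) < 1" using d by auto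
    show "cmod (deriv f z) \<le> cmod (deriv f 0) + e" if "z \<in> ball 0 (min d (1/2))" for z
      using d(2)[of z] that norm_triangle_ineq2[of "deriv f z" "deriv f 0"] by (simp add: dist_norm)
  qed
qed

text \<open>Both quotients tend to \<open>cmod (deriv f 0)\<close> at \<open>0\<close>, so a quotient that is constant near \<open>0\<close> has this value.\<close>

lemma value_if_constant:
  assumes s: "0 < s" "s < 1" and const: "\<And>x. 0 < x \<Longrightarrow> x \<le> s \<Longrightarrow> g x = g s"
    and ge: "\<And>r. 0 < r \<Longrightarrow> r < 1 \<Longrightarrow> cmod (deriv f 0) \<le> g r"
    and le: "\<And>r L. 0 < r \<Longrightarrow> r < 1 \<Longrightarrow> L \<ge> 0 \<Longrightarrow> (\<And>z. z \<in> ball 0 r \<Longrightarrow> cmod (deriv f z) \<le> L) \<Longrightarrow> g r \<le> L"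
  shows "g s = cmod (deriv f 0)"
proof (rule antisym)
  show "g s \<le> cmod (deriv f 0)"
  proof (rule field_le_epsilon)
    fix e :: real assume e: "e > 0"
    obtain r where r: "0 < r" "r < 1" "\<And>z. z \<in> ball 0 r \<Longrightarrow> cmod (deriv f z) \<le> cmod (deriv f 0) + e"
      using deriv_small_radius[OF e] by metis
    have "g (min r s) \<le> cmod (deriv f 0) + e"
      using r s e by (intro le) auto
    then show "g s \<le> cmod (deriv f 0) + e" using const[of "min r s"] r s by simp
  qed
qed (use ge s in auto)

lemma is_linear_if_constant_on_ball:
  assumes "0 < s" "s < 1" "f constant_on ball 0 s"
  shows "is_linear_fun f (ball 0 1)"
proof -
  have "(0::complex) islimpt ball 0 s"
    using assms by (intro interior_limit_point) (simp add: interior_open)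
  then have "f constant_on ball 0 1"
    using assms by (intro analytic_continuation'[OF holf, of "ball 0 s" 0]) auto
  then obtain c where "\<forall>x\<in>ball 0 1. f x = 0 * x + c" by (auto simp: constant_on_def)
  then show ?thesis unfolding is_linear_fun_def by blast
qed

text \<open>By the open mapping theorem the image contains a disc around \<open>f 0\<close>. The
  bound it gives is independent of \<open>n\<close>, so it also holds for the capacity; in both
  cases it rules out \<open>deriv f 0 = 0\<close>.\<close>

lemma phi_ndiam_bounded_below:
  assumes s: "0 < s" "s < 1" and nonlin: "\<not> is_linear_fun f (ball 0 1)"
  obtains d where "d > 0" "\<And>n. n \<ge> 2 \<Longrightarrow> phi_ndiam n f s \<ge> d"
proof -
  have "\<not> f constant_on ball 0 s" using is_linear_if_constant_on_ball[OF s] nonlin by blast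
  moreover have "f holomorphic_on ball 0 s" by (rule holomorphic_on_subset[OF holf]) (use s in auto)
  ultimately have "open (f ` ball 0 s)" by (intro open_mapping_thm[of f "ball 0 s" "ball 0 s"]) auto
  moreover have "f 0 \<in> f ` ball 0 s" using s by auto
  ultimately obtain d where d: "d > 0" "ball (f 0) d \<subseteq> f ` ball 0 s" by (meson openE)
  show thesis
  proof
    show "d / s > 0" using d s by simp
    fix n :: nat assume n: "n \<ge> 2"
    have "d * n_diam n (ball 0 1) \<le> n_diam n (f ` ball 0 s)"
      using n_diam_mono[OF n d(2) _ bounded_image[OF s(2)]] n_diam_ball[OF n d(1), of "f 0"] d by simp
    then show "phi_ndiam n f s \<ge> d / s"
      unfolding phi_ndiam_def using s n_diam_unit_ball_ge_1[OF n] by (simp add: field_simps)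
  qed
qed

section \<open>Monotonicity, convexity and the characterisation of strictness\<close>

lemma phi_cap_mono_on: "mono_on {0<..<1} (phi_cap f)"
proof (rule mono_onI)
  fix r s :: real assume "r \<in> {0<..<1}" "s \<in> {0<..<1}" "r \<le> s"
  then show "phi_cap f r \<le> phi_cap f s"
    using phi_ndiam_mono[of _ r s]
    by (intro LIMSEQ_le[OF phi_ndiam_tendsto_phi_cap phi_ndiam_tendsto_phi_cap] exI[of _ 2]) auto
qed

lemma phi_ndiam_mono_on: "n \<ge> 2 \<Longrightarrow> mono_on {0<..<1} (phi_ndiam n f)"
  using phi_ndiam_mono by (intro mono_onI) auto

lemma phi_ndiam_log_convex_on: "n \<ge> 2 \<Longrightarrow> log_convex_on {0<..<1} (phi_ndiam n f)"
  by (intro log_convex_on_unit_intervalI phi_ndiam_convex) auto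

lemma phi_cap_log_convex_on: "log_convex_on {0<..<1} (phi_cap f)"
proof (rule log_convex_on_unit_intervalI)
  fix t r1 r2 :: real
  assume *: "0 < t" "t < 1" "0 < r1" "r1 < r2" "r2 < 1"
  let ?r = "exp ((1 - t) * ln r1 + t * ln r2)"
  have "(1 - t) * ln r1 + t * ln r2 < 0"
    using * by (intro add_neg_neg mult_pos_neg) auto
  then have r: "0 < ?r" "?r < 1" by auto
  show "phi_cap f ?r \<le> (1 - t) * phi_cap f r1 + t * phi_cap f r2"
  proof (rule LIMSEQ_le[OF phi_ndiam_tendsto_phi_cap[OF r]])
    show "(\<lambda>n. (1 - t) * phi_ndiam n f r1 + t * phi_ndiam n f r2) \<longlonglongrightarrow> (1 - t) * phi_cap f r1 + t * phi_cap f r2"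
      using * by (intro tendsto_intros phi_ndiam_tendsto_phi_cap) auto
    show "\<exists>N. \<forall>n\<ge>N. phi_ndiam n f ?r \<le> (1 - t) * phi_ndiam n f r1 + t * phi_ndiam n f r2"
      using phi_ndiam_convex[of _ r1 r2 t] * by (intro exI[of _ 2]) auto
  qed
qed

lemma phi_ndiam_linear:
  assumes "n \<ge> 2" "0 < r" "r < 1" "\<And>z. z \<in> ball 0 1 \<Longrightarrow> f z = a * z + b"
  shows "phi_ndiam n f r = cmod a"
proof -
  have eq: "f ` ball 0 r = (\<lambda>z. a * z + b) ` ball 0 r"
    using assms by (intro image_cong) auto
  have "n_diam n (f ` ball 0 r) = cmod a * (r * n_diam n (ball 0 1))"
    unfolding eq using assms(1,2) by (subst n_diam_affine) (simp_all add: n_diam_ball[OF assms(1,2)])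
  then show ?thesis
    unfolding phi_ndiam_def using assms(1-3) n_diam_unit_ball_ge_1[OF assms(1)] by simp
qed

lemma phi_ndiam_strict_mono_on_iff:
  assumes n: "n \<ge> 2"
  shows "strict_mono_on {0<..<1} (phi_ndiam n f) \<longleftrightarrow> \<not> is_linear_fun f (ball 0 1)"
proof
  assume "strict_mono_on {0<..<1} (phi_ndiam n f)"
  then show "\<not> is_linear_fun f (ball 0 1)"
    using phi_ndiam_linear[OF n] not_strict_mono_on_if_constant
    unfolding is_linear_fun_def by metis
next
  assume nonlin: "\<not> is_linear_fun f (ball 0 1)"
  show "strict_mono_on {0<..<1} (phi_ndiam n f)"
  proof (rule ccontr)
    assume "\<not> ?thesis"
    then obtain s where s: "0 < s" "s < 1" "\<And>x. 0 < x \<Longrightarrow> x \<le> s \<Longrightarrow> phi_ndiam n f x = phi_ndiam n f s"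
      using log_convex_constant_if_not_strict[OF phi_ndiam_mono_on phi_ndiam_log_convex_on] n by metis
    have val: "phi_ndiam n f s = cmod (deriv f 0)"
      using s
    proof (rule value_if_constant)
      show "cmod (deriv f 0) \<le> phi_ndiam n f r" if "0 < r" "r < 1" for r
        using n that by (rule phi_ndiam_ge)
      show "phi_ndiam n f r \<le> L" if "0 < r" "r < 1" "L \<ge> 0" "\<And>z. z \<in> ball 0 r \<Longrightarrow> cmod (deriv f z) \<le> L" for r L
        using n that by (rule phi_ndiam_le)
    qed
    \<comment> \<open>A zero derivative would make the quotient at \<open>s\<close> equal to 0,
      below its positive lower bound.\<close>
    have "deriv f 0 \<noteq> 0"
      using phi_ndiam_bounded_below[OF s(1,2) nonlin] n val by (metis norm_zero not_le)
    moreover have "n_diam n (f ` ball 0 r) = r * (cmod (deriv f 0) * n_diam n (ball 0 1))" if "0 < r" "r < s" for r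
      using s(3)[of r] that val n_diam_unit_ball_ge_1[OF n] by (simp add: phi_ndiam_def field_simps)
    ultimately show False using is_linear_if_n_diam_eq[OF n s(1,2)] nonlin by blast
  qed
qed

lemma phi_cap_strict_mono_on_iff:
  "strict_mono_on {0<..<1} (phi_cap f) \<longleftrightarrow> \<not> is_linear_fun f (ball 0 1)"
proof
  assume strict: "strict_mono_on {0<..<1} (phi_cap f)"
  show "\<not> is_linear_fun f (ball 0 1)"
  proof
    assume "is_linear_fun f (ball 0 1)"
    then obtain a b where ab: "\<And>z. z \<in> ball 0 1 \<Longrightarrow> f z = a * z + b" unfolding is_linear_fun_def by blast
    \<comment> \<open>All \<open>phi_ndiam n f r\<close> with \<open>n\<close> at least 2 equal
      \<open>cmod a\<close>, so their limit does too.\<close>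
    have "phi_cap f r = cmod a" if r: "0 < r" "r < 1" for r
      using phi_ndiam_linear[OF _ r ab] by (intro antisym phi_cap_le_if phi_cap_ge_if r) auto
    then show False using strict not_strict_mono_on_if_constant by blast
  qed
next
  assume nonlin: "\<not> is_linear_fun f (ball 0 1)"
  show "strict_mono_on {0<..<1} (phi_cap f)"
  proof (rule ccontr)
    assume "\<not> ?thesis"
    then obtain s where s: "0 < s" "s < 1" "\<And>x. 0 < x \<Longrightarrow> x \<le> s \<Longrightarrow> phi_cap f x = phi_cap f s"
      using log_convex_constant_if_not_strict[OF phi_cap_mono_on phi_cap_log_convex_on] by metis
    have val: "phi_cap f s = cmod (deriv f 0)"
      using s
    proof (rule value_if_constant)
      show "cmod (deriv f 0) \<le> phi_cap f r" if "0 < r" "r < 1" for r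
        using that by (intro phi_cap_ge_if phi_ndiam_ge)
      show "phi_cap f r \<le> L" if "0 < r" "r < 1" "L \<ge> 0" "\<And>z. z \<in> ball 0 r \<Longrightarrow> cmod (deriv f z) \<le> L" for r L
        using that by (intro phi_cap_le_if phi_ndiam_le)
    qed
    obtain d where d: "d > 0" "\<And>n. n \<ge> 2 \<Longrightarrow> phi_ndiam n f s \<ge> d"
      using phi_ndiam_bounded_below[OF s(1,2) nonlin] by metis
    then have "phi_cap f s \<ge> d" by (intro phi_cap_ge_if s) auto
    then have "deriv f 0 \<noteq> 0" using val d by auto
    moreover have "trans_diam (f ` ball 0 s) = s * cmod (deriv f 0)"
      using val s by (simp add: phi_cap_def trans_diam_ball field_simps)
    ultimately show False using is_linear_if_trans_diam_eq[OF s(1,2)] nonlin by blast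
  qed
qed

end

theorem theorem1p6:
  fixes f :: "complex \<Rightarrow> complex" and n :: nat
  assumes "f analytic_on ball 0 1" and "n \<ge> 2"
  shows "mono_on {0<..<1} (phi_cap f) \<and> log_convex_on {0<..<1} (phi_cap f)
       \<and> mono_on {0<..<1} (phi_ndiam n f) \<and> log_convex_on {0<..<1} (phi_ndiam n f)
       \<and> (strict_mono_on {0<..<1} (phi_cap f) \<longleftrightarrow> \<not> is_linear_fun f (ball 0 1))
       \<and> (strict_mono_on {0<..<1} (phi_ndiam n f) \<longleftrightarrow> \<not> is_linear_fun f (ball 0 1))"
proof -
  interpret holomorphic_disc f
    by (rule holomorphic_disc.intro[OF analytic_imp_holomorphic[OF assms(1)]])
  show ?thesis
    using phi_cap_mono_on phi_cap_log_convex_on phi_ndiam_mono_on[OF assms(2)]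
      phi_ndiam_log_convex_on[OF assms(2)] phi_cap_strict_mono_on_iff
      phi_ndiam_strict_mono_on_iff[OF assms(2)] by blast
qed

end
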